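(* Let $m\in\mathbb{N}$, $L,T\in\mathbb{R}_{>0}$, and $a_1,\dots,a_m\in(1,2)$. Define $\beta_1=1$, $\gamma_0=\gamma_1=2$ and recursively define $\beta_2,\dots,\beta_{m+1}$, $\gamma_2,\dots,\gamma_{m+1}$ and $\mu_1,\dots,\mu_m$ via $$\beta_{j+1}=\Bigl(\beta_j^j+\frac{a_j}{\gamma_j^j}\Bigr)^{\frac1j},\qquad \gamma_{j+1}=\Bigl(\frac{2}{2-a_j}\Bigr)^{\frac1j}\gamma_j,\qquad \mu_j=\frac{j+1}{j}\cdot\frac{\gamma_j^j}{\gamma_{j-1}^{j-1}}\cdot\frac{\beta_{j+1}}{a_j-1}$$ for $j=1,\dots,m$. Additionally, define $\lambda_0=1$. Consider the $m$th order implicit robust exact differentiator $\mathcal{D}^{(m)}_T$ (defined in the context) with initial values $z_{1,1},\dots,z_{m+1,1}\in\mathbb{R}$, and suppose that its parameters $\lambda_1,\dots,\lambda_{m+1}\in\mathbb{R}_{>0}$ satisfy $\lambda_{m+1}>1$ and $$\frac{\lambda_{m-j+1}}{\lambda_{m-j}}>\frac{\lambda_{m-j+2}}{\lambda_{m-j+1}}\,\mu_j\qquad\text{for }j=1,\dots,m.$$ Then, for every $f\in\mathcal{F}^{(m)}_L$ and every $(\eta_k)\in\mathcal{E}_N$, with noise bound $N\in\mathbb{R}_{\ge0}$, there exists a finite integer $K\in\mathbb{N}$, independent of $f$ and $(\eta_k)$ except for the initial conditions $f(0),f^{(1)}(0),\dots,f^{(m)}(0)$ and the noise bound $N$, such that,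 when applying the input $u_k=f(kT)+\eta_k$ to the differentiator, its outputs satisfy $$|y_{i,k}-f^{(i)}(kT)|\le c_{i,m+1}L\left(T+d_i\sqrt[m+1]{\frac NL}\right)^{m-i+1}\quad\text{with}\quad d_i=\max_{p=1,\dots,m-i+1}\frac{\beta_p\gamma_{m+1}}{\sqrt[m+1]{2}}\sqrt[p]{\frac{\lambda_{m-p+1}c_{i,m-p+1}}{\binom{m-i+1}{p}c_{i,m+1}}}$$ for all $i=1,\dots,m$ and all $k\ge K$. If, additionally, $N\le\bar N$ holds with $$\bar N=\min_{p=0,\dots,m}\frac{LT^{m+1}}{2^m\beta_{m-p+1}^{m+1}\gamma_{m+1}^{m+1}}\left(\frac{\lambda_{m+1}-1}{\lambda_p}\right)^{\frac{m+1}{m-p+1}},$$ then the differentiator moreover is in discrete-time sliding mode (i.e., $z_{1,k+1}=u_k$ holds) for all $k\ge K$.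
   Context: Notation: $\mathbb{N}=\{1,2,\dots\}$. For $y,p\in\mathbb{R}$ with $p\neq0$, $\lfloor y\rceil^{p}=|y|^p\operatorname{sign}(y)$; $\lfloor y\rceil^0$ is the set-valued sign: $\lfloor y\rceil^0=\{\operatorname{sign}(y)\}$ for $y\ne0$ and $\lfloor 0\rceil^0=[-1,1]$. Sums and products of scalars and sets are taken elementwise. Signals and noise: $\mathcal{F}^{(m)}_L$ is the set of $m$ times differentiable functions $f:\mathbb{R}_{\ge0}\to\mathbb{R}$ whose $m$th derivative is Lipschitz continuous and satisfies $|f^{(m+1)}(t)|\le L$ for almost every $t\ge0$. $\mathcal{E}_N$ is the set of real sequences $(\eta_k)$ with $|\eta_k|\le N$ for all $k$. Constants: $c_{i,j}$ for $i,j\in\mathbb{N}$ are defined by $c_{i,j}=\frac{(j-1)c_{i,j-1}+i\,c_{i-1,j-1}}{j}$ with $c_{0,0}=1$ and $c_{0,j}=c_{i,0}=0$ for $i,j\neq0$. Differentiator: the $m$th order implicit robust exact differentiator $\mathcal{D}^{(m)}_T$ with sampling time $T$ and parameters $L,\lambda_1,\dots,\lambda_{m+1}>0$ has state $(z_{1,k},\dots,z_{m+1,k})\in\mathbb{R}^{m+1}$, fixed initial values $z_{1,1},\dots,z_{m+1,1}$, and maps an input sequence $(u_k)$ to outputs $y_{1,k},\dots,y_{m,k}$ via the implicit relations, for $k\ge1$, $$z_{i,k+1}=z_{i,k}+T\lambda_iL^{\frac{i}{m+1}}\lfloor u_k-z_{1,k+1}\rceil^{\frac{m-i+1}{m+1}}+Tz_{i+1,k+1}\quad(i=1,\dots,m),$$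 $$z_{m+1,k+1}\in z_{m+1,k}+T\lambda_{m+1}L\lfloor u_k-z_{1,k+1}\rceil^0,$$ $$y_{i,k}=\sum_{j=i}^{m}T^{j-i}c_{i,j}z_{j+1,k+1}\quad(i=1,\dots,m).$$ For every initial value and input these relations have a unique solution. The differentiator is said to be in discrete-time sliding mode at time index $k$ if the set on the right-hand side of the inclusion contains more than one element, i.e. if $z_{1,k+1}=u_k$. *)

theory Defs
  imports "HOL-Analysis.Analysis"
begin

definition signed_pow :: "real \<Rightarrow> real \<Rightarrow> real" where
  "signed_pow y p = \<bar>y\<bar> powr p * sgn y"

definition signed_pow0 :: "real \<Rightarrow> real set" where
  "signed_pow0 y = (if y = 0 then {-1..1} else {sgn y})"

text \<open>Derivatives on the closed half line, i.e. one-sided at 0; the values of the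
  signal at negative arguments do not matter.\<close>

fun half_line_deriv :: "nat \<Rightarrow> (real \<Rightarrow> real) \<Rightarrow> real \<Rightarrow> real" where
  "half_line_deriv 0 f = f"
| "half_line_deriv (Suc n) f = (\<lambda>t. vector_derivative (half_line_deriv n f) (at t within {0..}))"

text \<open>The conjunct on differentiability in the almost-everywhere condition says that
  the derivative of order \<open>m + 1\<close> exists where it is bounded, as \<open>vector_derivative\<close> is an
  arbitrary value otherwise. It removes no signal: a Lipschitz function
  is differentiable almost everywhere.\<close>

definition signal_class :: "nat \<Rightarrow> real \<Rightarrow> (real \<Rightarrow> real) set" where
  "signal_class m L = {f.
     (\<forall>i<m. half_line_deriv i f differentiable_on {0..}) \<and>
     (\<exists>C. C-lipschitz_on {0..} (half_line_deriv m f)) \<and>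
     (AE t in lebesgue_on {0..}.
        half_line_deriv m f differentiable (at t within {0..}) \<and>
        \<bar>half_line_deriv (Suc m) f t\<bar> \<le> L)}"

text \<open>Sequences are indexed from 1; the value at index 0 is irrelevant.\<close>

definition noise_class :: "real \<Rightarrow> (nat \<Rightarrow> real) set" where
  "noise_class N = {\<eta>. \<forall>k\<ge>1. \<bar>\<eta> k\<bar> \<le> N}"

fun c_const :: "nat \<Rightarrow> nat \<Rightarrow> real" where
  "c_const 0 0 = 1"
| "c_const 0 (Suc j) = 0"
| "c_const (Suc i) 0 = 0"
| "c_const (Suc i) (Suc j) =
     (real j * c_const (Suc i) j + real (Suc i) * c_const i j) / real (Suc j)"

text \<open>The right-hand side of the inclusion for the last state component, where
  \<open>z i k\<close> is the \<open>i\<close>-th component of the state at time index \<open>k\<close>.\<close>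

definition last_state_rhs ::
  "nat \<Rightarrow> real \<Rightarrow> real \<Rightarrow> (nat \<Rightarrow> real) \<Rightarrow> (nat \<Rightarrow> real) \<Rightarrow> (nat \<Rightarrow> nat \<Rightarrow> real) \<Rightarrow> nat \<Rightarrow> real set"
where
  "last_state_rhs m T L lam u z k =
     (\<lambda>s. z (m + 1) k + T * lam (m + 1) * L * s) ` signed_pow0 (u k - z 1 (k + 1))"

text \<open>\<open>z\<close> is a trajectory of the implicit robust exact differentiator of order \<open>m\<close> with
  initial values \<open>zinit\<close> and input \<open>u\<close>.\<close>

definition differentiator_trajectory ::
  "nat \<Rightarrow> real \<Rightarrow> real \<Rightarrow> (nat \<Rightarrow> real) \<Rightarrow> (nat \<Rightarrow> real) \<Rightarrow> (nat \<Rightarrow> real) \<Rightarrow> (nat \<Rightarrow> nat \<Rightarrow> real) \<Rightarrow> bool"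
where
  "differentiator_trajectory m T L lam zinit u z \<longleftrightarrow>
     (\<forall>i\<in>{1..m + 1}. z i 1 = zinit i) \<and>
     (\<forall>k\<ge>1.
        (\<forall>i\<in>{1..m}. z i (k + 1) =
           z i k
           + T * lam i * L powr (real i / real (m + 1))
               * signed_pow (u k - z 1 (k + 1)) (real (m - i + 1) / real (m + 1))
           + T * z (i + 1) (k + 1)) \<and>
        z (m + 1) (k + 1) \<in> last_state_rhs m T L lam u z k)"

definition differentiator_output ::
  "nat \<Rightarrow> real \<Rightarrow> (nat \<Rightarrow> nat \<Rightarrow> real) \<Rightarrow> nat \<Rightarrow> nat \<Rightarrow> real" where
  "differentiator_output m T z i k =
     (\<Sum>j=i..m. T ^ (j - i) * c_const i j * z (j + 1) (k + 1))"

definition sliding_mode ::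
  "nat \<Rightarrow> real \<Rightarrow> real \<Rightarrow> (nat \<Rightarrow> real) \<Rightarrow> (nat \<Rightarrow> real) \<Rightarrow> (nat \<Rightarrow> nat \<Rightarrow> real) \<Rightarrow> nat \<Rightarrow> bool" where
  "sliding_mode m T L lam u z k \<longleftrightarrow>
     (\<exists>v\<in>last_state_rhs m T L lam u z k. \<exists>w\<in>last_state_rhs m T L lam u z k. v \<noteq> w)"

lemma sliding_mode_iff:
  assumes "T > 0" "L > 0" "lam (m + 1) > 0"
  shows "sliding_mode m T L lam u z k \<longleftrightarrow> z 1 (k + 1) = u k"
proof
  assume "sliding_mode m T L lam u z k"
  then show "z 1 (k + 1) = u k"
    by (auto simp: sliding_mode_def last_state_rhs_def signed_pow0_def split: if_splits)
next
  assume eq: "z 1 (k + 1) = u k"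
  let ?g = "\<lambda>s. z (m + 1) k + T * lam (m + 1) * L * s"
  have "?g 0 \<in> last_state_rhs m T L lam u z k" "?g 1 \<in> last_state_rhs m T L lam u z k"
    using eq unfolding last_state_rhs_def signed_pow0_def by (auto intro!: imageI)
  moreover have "?g 0 \<noteq> ?g 1"
    using assms by simp
  ultimately show "sliding_mode m T L lam u z k"
    unfolding sliding_mode_def by blast
qed

end

theory Submission
  imports Defs "HOL-Computational_Algebra.Polynomial"
begin

text \<open>Subtract from the states \<open>z i\<close> the scaled backward differences of the signal. The
  implicit relations then say that every step changes the error component \<open>i\<close> by the
  term driving it, and that this term is the injection term plus the error component
  \<open>i + 1\<close>. Comparing the injection term with its noise-free value, obtained by
  letting component \<open>i\<close> alone determine the argument of the root, gives quantities
  \<open>gap j\<close> which together with the last component form a homogeneous Lyapunov function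
  \<open>V\<close>. By concavity of \<open>x \<mapsto> x\<^bsup>j/(j+1)\<^esup>\<close> a bound on \<open>V\<close> after the step bounds all driving
  terms, and going one step backward in time from a point where \<open>V\<close> is attained, the condition
  on the ratios of the parameters forces \<open>V\<close> to have been larger by a fixed factor, unless
  \<open>V\<close> is already at the noise level. Without noise a small value of \<open>V\<close>
  enforces sliding, after which the errors vanish one after the other.
  The outputs differ from the derivatives by these errors and by the truncation error
  of the backward difference formula, which Rolle's theorem bounds.\<close>

text \<open>The obstacle is a mismatch of degrees. On the level \<open>V = \<rho>\<close> the change
  of \<open>gap j\<close> that can be guaranteed in one step is of order \<rho>^(j-1), while
  \<open>gap j\<close> itself is of order \<rho>^j. The relative contraction is thus of order T /
  \<rho>: a factor q > 1 can be fixed only below a given level. That suffices, because the initial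
  level depends on the signal only through its derivatives at 0, and this makes K uniform. Geometric
  decay reaches every positive level in finite time but never 0, hence the separate sliding argument
  without noise. The noise level is the \<rho> with 2 (\<rho> / \<gamma> (m+1))^(m+1) = N / L; the
  factor 2 is the constant in the Hoelder estimate for signed roots, whose worst case are opposite
  arguments.\<close>

section \<open>Signed powers and their differences\<close>

definition spow :: "nat \<Rightarrow> real \<Rightarrow> real" where
  "spow j x = sgn x * \<bar>x\<bar> ^ j"

lemma spow_minus [simp]: "spow j (- x) = - spow j x"
  by (simp add: spow_def sgn_minus)

lemma spow_zero [simp]: "spow j 0 = 0"
  by (simp add: spow_def)

lemma spow_1 [simp]: "spow (Suc 0) x = x"
  by (simp add: spow_def mult_sgn_abs)

text \<open>Positivity of j matters: \<open>spow 0 0 = 0\<close>, whereas 0 ^ 0 = 1.\<close>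

lemma spow_nonneg: "x \<ge> 0 \<Longrightarrow> j > 0 \<Longrightarrow> spow j x = x ^ j"
  by (cases "x = 0") (auto simp: spow_def)

lemma spow_nonpos: "x \<le> 0 \<Longrightarrow> j > 0 \<Longrightarrow> spow j x = - ((- x) ^ j)"
  using spow_nonneg[of "- x" j] by simp

lemma abs_spow: "j > 0 \<Longrightarrow> \<bar>spow j x\<bar> = \<bar>x\<bar> ^ j"
  by (cases "x = 0") (auto simp: spow_def abs_mult power_abs)

lemma spow_root: "j > 0 \<Longrightarrow> spow j (root j x) = x"
  using sgn_power_root[of j x] by (simp add: spow_def)

lemma spow_mono_iff:
  assumes "j > 0"
  shows "spow j x \<le> spow j y \<longleftrightarrow> x \<le> y"
proof -
  have "spow j x \<le> spow j y \<longleftrightarrow> root j (spow j x) \<le> root j (spow j y)"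
    using assms by simp
  then show ?thesis
    using assms by (simp add: spow_def root_sgn_power)
qed

text \<open>Weighted arithmetic-geometric mean inequality. The excess of the right side for j + 1 is
  x times the excess for j plus (x - c) * (x^(j+1) - c^(j+1)), a product of factors of equal
  sign.\<close>

lemma young_power:
  fixes x c :: real
  assumes "x \<ge> 0" "c \<ge> 0"
  shows "real (Suc j) * c * x ^ j \<le> real j * x ^ Suc j + c ^ Suc j"
proof (induction j)
  case 0
  then show ?case by simp
next
  case (Suc j)
  have nn: "(x - c) * (x ^ Suc j - c ^ Suc j) \<ge> 0"
    using assms power_mono[of x c "Suc j"] power_mono[of c x "Suc j"]
    by (cases "x \<le> c") (auto intro: mult_nonpos_nonpos)
  have "real (Suc j) * x ^ Suc (Suc j) + c ^ Suc (Suc j) - real (Suc (Suc j)) * c * x ^ Suc j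
     = x * (real j * x ^ Suc j + c ^ Suc j - real (Suc j) * c * x ^ j)
       + (x - c) * (x ^ Suc j - c ^ Suc j)"
    by (simp add: algebra_simps)
  moreover have "x * (real j * x ^ Suc j + c ^ Suc j - real (Suc j) * c * x ^ j) \<ge> 0"
    using Suc assms by (intro mult_nonneg_nonneg) auto
  ultimately show ?case
    using nn by linarith
qed

text \<open>The extreme case is x = c, y = - c, whence the factor 2. For equal signs the larger
  absolute value is at least c and contributes one more such factor to the difference; for opposite
  signs the powers of the absolute values add up and \<open>young_power\<close> applies to
  each.\<close>

lemma spow_diff_Suc_ge:
  assumes "j > 0" "c \<ge> 0" "2 * c ^ j \<le> spow j x - spow j y"
  shows "2 * c ^ Suc j \<le> spow (Suc j) x - spow (Suc j) y"
proof -
  have same: "2 * c ^ Suc j \<le> u ^ Suc j - v ^ Suc j"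
    if "0 \<le> v" "v \<le> u" "2 * c ^ j \<le> u ^ j - v ^ j" for u v :: real
  proof -
    have "c ^ j \<le> u ^ j"
      using that(3) zero_le_power[OF \<open>c \<ge> 0\<close>, of j] zero_le_power[OF that(1), of j]
      by linarith
    then have cu: "c \<le> u"
      using \<open>j > 0\<close> \<open>c \<ge> 0\<close> that by (simp add: power_mono_iff)
    have "2 * c ^ Suc j = c * (2 * c ^ j)" by simp
    also have "\<dots> \<le> u * (u ^ j - v ^ j)"
      using that cu \<open>c \<ge> 0\<close> by (intro mult_mono) auto
    also have "\<dots> \<le> u ^ Suc j - v ^ Suc j"
      using that by (simp add: algebra_simps mult_left_mono mult_right_mono)
    finally show ?thesis .
  qed
  have "y \<le> x"
    using assms spow_mono_iff[OF \<open>j > 0\<close>, of y x] zero_le_power[OF \<open>c \<ge> 0\<close>, of j] by linarith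
  consider "0 \<le> y" | "x \<le> 0" | "y < 0" "0 < x" by linarith
  then show ?thesis
  proof cases
    case 1
    then show ?thesis
      using assms same[of y x] \<open>y \<le> x\<close> by (simp add: spow_nonneg)
  next
    case 2
    then show ?thesis
      using assms same[of "-x" "-y"] \<open>y \<le> x\<close> by (simp add: spow_nonpos)
  next
    case 3
    define u where "u = - y"
    have u: "u > 0" "y = - u" using 3 by (auto simp: u_def)
    have s: "2 * c ^ j \<le> x ^ j + u ^ j"
      using assms 3 u by (simp add: spow_nonneg)
    have "real j * (2 * c ^ Suc j) = real (Suc j) * c * (2 * c ^ j) - 2 * c ^ Suc j"
      by (simp add: algebra_simps)
    also have "\<dots> \<le> real (Suc j) * c * (x ^ j + u ^ j) - 2 * c ^ Suc j"
      using s \<open>c \<ge> 0\<close> by (simp add: mult_left_mono)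
    also have "\<dots> \<le> real j * (x ^ Suc j + u ^ Suc j)"
      using young_power[of x c j] young_power[of u c j] 3 u \<open>c \<ge> 0\<close>
      by (simp add: algebra_simps)
    finally have "2 * c ^ Suc j \<le> x ^ Suc j + u ^ Suc j"
      using \<open>j > 0\<close> by (simp only: mult_le_cancel_left_pos of_nat_0_less_iff)
    then show ?thesis
      using 3 u by (simp add: spow_nonneg del: power_Suc)
  qed
qed

lemma spow_diff_less:
  assumes "j > 0" "c \<ge> 0" "\<bar>spow (Suc j) x - spow (Suc j) y\<bar> < 2 * c ^ Suc j"
  shows "\<bar>spow j x - spow j y\<bar> < 2 * c ^ j"
proof (rule ccontr)
  assume "\<not> ?thesis"
  then have "2 * c ^ j \<le> spow j x - spow j y \<or> 2 * c ^ j \<le> spow j y - spow j x" by linarith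
  then have "2 * c ^ Suc j \<le> spow (Suc j) x - spow (Suc j) y
      \<or> 2 * c ^ Suc j \<le> spow (Suc j) y - spow (Suc j) x"
    using spow_diff_Suc_ge[OF assms(1,2)] by blast
  with assms(3) show False by linarith
qed

text \<open>A mean value estimate: as a function of \<open>spow j x\<close>, the power
  \<open>spow (Suc j) x\<close> has derivative (j+1)/j * |x|. This is the source of the factors
  (j+1)/j and \<open>\<beta> (j + 1)\<close> in \<open>\<mu> j\<close>.\<close>

lemma spow_diff_Suc_le:
  assumes "j > 0" "\<bar>x\<bar> \<le> B" "\<bar>y\<bar> \<le> B" "y \<le> x"
  shows "real j * (spow (Suc j) x - spow (Suc j) y) \<le> real (Suc j) * B * (spow j x - spow j y)"
proof -
  have same: "real j * (u ^ Suc j - v ^ Suc j) \<le> real (Suc j) * B * (u ^ j - v ^ j)"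
    if "0 \<le> v" "v \<le> u" "u \<le> B" for u v :: real
  proof -
    have "real j * (u ^ Suc j - v ^ Suc j) \<le> real (Suc j) * u * (u ^ j - v ^ j)"
      using young_power[of v u j] that by (simp add: algebra_simps)
    also have "\<dots> \<le> real (Suc j) * B * (u ^ j - v ^ j)"
      using that by (intro mult_right_mono mult_left_mono) (auto simp: power_mono)
    finally show ?thesis .
  qed
  consider "0 \<le> y" | "x \<le> 0" | "y < 0" "0 < x" by linarith
  then show ?thesis
  proof cases
    case 1
    then show ?thesis
      using assms same[of y x] by (simp add: spow_nonneg del: power_Suc)
  next
    case 2
    then show ?thesis
      using assms same[of "-x" "-y"] by (simp add: spow_nonpos del: power_Suc)
  next
    case 3
    have "real j * x ^ Suc j \<le> real (Suc j) * B * x ^ j"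
      "real j * (- y) ^ Suc j \<le> real (Suc j) * B * (- y) ^ j"
      using same[of 0 x] same[of 0 "-y"] assms 3 by (simp_all add: power_0_left del: power_Suc)
    then show ?thesis
      using 3 assms(1) by (simp add: spow_nonneg spow_nonpos distrib_left del: power_Suc)
  qed
qed

section \<open>The error dynamics\<close>

text \<open>Indices count from the last state component: in terms of the differentiator,
  \<open>\<Lambda> j\<close> is \<open>lam (m + 1 - j)\<close>.\<close>

locale error_cascade =
  fixes m :: nat and T :: real and a \<beta> \<gamma> \<Lambda> :: "nat \<Rightarrow> real"
  assumes m_pos: "m \<ge> 1" and T_pos: "T > 0"
    and a_bounds: "\<And>j. j \<in> {1..m} \<Longrightarrow> 1 < a j \<and> a j < 2"
    and \<beta>_1: "\<beta> 1 = 1" and \<gamma>_1: "\<gamma> 1 = 2"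
    and \<beta>_pos: "\<And>j. j \<in> {1..Suc m} \<Longrightarrow> \<beta> j > 0"
    and \<gamma>_pos: "\<And>j. j \<le> Suc m \<Longrightarrow> \<gamma> j > 0"
    and \<beta>_pow: "\<And>j. j \<in> {1..m} \<Longrightarrow> \<beta> (Suc j) ^ j = \<beta> j ^ j + a j / \<gamma> j ^ j"
    and \<gamma>_pow: "\<And>j. j \<in> {1..m} \<Longrightarrow> (2 - a j) * \<gamma> (Suc j) ^ j = 2 * \<gamma> j ^ j"
    and \<Lambda>_pos: "\<And>j. j \<le> Suc m \<Longrightarrow> \<Lambda> j > 0"
    and \<Lambda>_top: "\<Lambda> (Suc m) = 1"
    and \<Lambda>_0: "\<Lambda> 0 > 1"
    and gain: "\<And>j. j \<in> {1..m} \<Longrightarrow>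
      real (Suc j) * \<beta> (Suc j) * \<Lambda> (Suc j) * (2 * \<Lambda> (j - 1) / \<gamma> (j - 1) ^ (j - 1))
        < real j * \<Lambda> j * (2 * (a j - 1) * \<Lambda> j / \<gamma> j ^ j)"
begin

definition gap :: "nat \<Rightarrow> (nat \<Rightarrow> real) \<Rightarrow> real" where
  "gap j R = spow j (R (Suc j)) - spow j (R j)"

text \<open>The j-th root gives each gap the homogeneity degree of \<open>R\<close> itself; sublevel
  sets then become the polynomial bounds of \<open>V_le_iff\<close>.\<close>

definition V :: "(nat \<Rightarrow> real) \<Rightarrow> real" where
  "V R = Max (insert \<bar>R 1\<bar> ((\<lambda>j. \<gamma> j * root j (\<bar>gap j R\<bar> / a j)) ` {1..m}))"

text \<open>The error of state component \<open>m + 2 - j\<close>, divided by \<open>- L\<close>, is written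
  \<open>\<Lambda> j * spow j (R j)\<close>; its signed root \<open>R j\<close> avoids fractional powers. Likewise \<open>s\<close> is the
  signed root of the injection argument \<open>(u k - z 1 (k + 1)) / L\<close>, and \<open>E (Suc m)\<close> is the scaled noise.\<close>

definition step :: "real \<Rightarrow> (nat \<Rightarrow> real) \<Rightarrow> (nat \<Rightarrow> real) \<Rightarrow> (nat \<Rightarrow> real) \<Rightarrow> bool" where
  "step s E R R' \<longleftrightarrow>
     (\<forall>j\<in>{1..Suc m}. E j = \<Lambda> j * (spow j s - spow j (R' j))) \<and>
     (\<forall>j\<le>m. \<Lambda> (Suc j) * (spow (Suc j) (R (Suc j)) - spow (Suc j) (R' (Suc j))) = T * E j) \<and>
     \<bar>E 0\<bar> \<le> \<Lambda> 0 + 1 \<and>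
     (s > 0 \<longrightarrow> E 0 \<ge> \<Lambda> 0 - 1) \<and> (s < 0 \<longrightarrow> E 0 \<le> - (\<Lambda> 0 - 1))"

lemma gap_uminus: "gap j (\<lambda>i. - R i) = - gap j R"
  by (simp add: gap_def)

lemma V_uminus: "V (\<lambda>i. - R i) = V R"
  by (simp add: V_def gap_uminus)

lemma step_uminus: "step s E R R' \<Longrightarrow> step (- s) (\<lambda>j. - E j) (\<lambda>j. - R j) (\<lambda>j. - R' j)"
  unfolding step_def by (auto simp: algebra_simps)

lemma
  assumes "step s E R R'"
  shows step_injection: "j \<in> {1..Suc m} \<Longrightarrow> E j = \<Lambda> j * (spow j s - spow j (R' j))"
    and step_update: "j \<le> m \<Longrightarrow>
      \<Lambda> (Suc j) * (spow (Suc j) (R (Suc j)) - spow (Suc j) (R' (Suc j))) = T * E j"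
    and step_last: "\<bar>E 0\<bar> \<le> \<Lambda> 0 + 1"
    and step_last_pos: "s > 0 \<Longrightarrow> \<Lambda> 0 - 1 \<le> E 0"
  using assms unfolding step_def by blast+

lemma V_nonneg: "V R \<ge> 0"
proof -
  have "\<bar>R 1\<bar> \<le> V R" unfolding V_def by (intro Max_ge) auto
  then show ?thesis by linarith
qed

lemma root_le_iff:
  assumes "j \<in> {1..m}" "\<rho> \<ge> 0"
  shows "\<gamma> j * root j (x / a j) \<le> \<rho> \<longleftrightarrow> x \<le> a j * (\<rho> / \<gamma> j) ^ j"
proof -
  have p: "j > 0" "\<gamma> j > 0" "a j > 0"
    using assms a_bounds[of j] \<gamma>_pos[of j] by auto
  have "\<gamma> j * root j (x / a j) \<le> \<rho> \<longleftrightarrow> root j (x / a j) \<le> root j ((\<rho> / \<gamma> j) ^ j)"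
    using p assms by (simp add: real_root_power_cancel pos_le_divide_eq mult.commute)
  also have "\<dots> \<longleftrightarrow> x / a j \<le> (\<rho> / \<gamma> j) ^ j"
    using p by simp
  also have "\<dots> \<longleftrightarrow> x \<le> a j * (\<rho> / \<gamma> j) ^ j"
    using p by (simp add: pos_divide_le_eq mult.commute)
  finally show ?thesis .
qed

lemma V_le_iff:
  assumes "\<rho> \<ge> 0"
  shows "V R \<le> \<rho> \<longleftrightarrow> \<bar>R 1\<bar> \<le> \<rho> \<and> (\<forall>j\<in>{1..m}. \<bar>gap j R\<bar> \<le> a j * (\<rho> / \<gamma> j) ^ j)"
  unfolding V_def using root_le_iff[OF _ assms] by (subst Max_le_iff) auto

lemma V_attained:
  "\<bar>R 1\<bar> = V R \<or> (\<exists>j\<in>{1..m}. \<bar>gap j R\<bar> = a j * (V R / \<gamma> j) ^ j)"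
proof -
  have "V R \<in> insert \<bar>R 1\<bar> ((\<lambda>j. \<gamma> j * root j (\<bar>gap j R\<bar> / a j)) ` {1..m})"
    unfolding V_def by (rule Max_in) auto
  then consider "V R = \<bar>R 1\<bar>" | j where "j \<in> {1..m}" "V R = \<gamma> j * root j (\<bar>gap j R\<bar> / a j)"
    by auto
  then show ?thesis
  proof cases
    case 2
    have p: "j > 0" "\<gamma> j > 0" "a j > 0"
      using 2 a_bounds[of j] \<gamma>_pos[of j] by auto
    have "(V R / \<gamma> j) ^ j = \<bar>gap j R\<bar> / a j"
      using p 2(2) by simp
    then have "\<bar>gap j R\<bar> = a j * (V R / \<gamma> j) ^ j"
      using p by simp
    with 2 show ?thesis by blast
  qed auto
qed

text \<open>The j-th power of \<open>R (Suc j)\<close> differs from that of \<open>R j\<close> by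
  \<open>gap j\<close>; adding the two bounds reproduces the recursion that defines
  \<open>\<beta>\<close>.\<close>

lemma abs_le_\<beta>:
  assumes "V R \<le> \<rho>" "j \<in> {1..Suc m}"
  shows "\<bar>R j\<bar> \<le> \<beta> j * \<rho>"
proof -
  have \<rho>: "\<rho> \<ge> 0" using assms V_nonneg[of R] by linarith
  have V: "\<bar>R 1\<bar> \<le> \<rho>" "\<And>j. j \<in> {1..m} \<Longrightarrow> \<bar>gap j R\<bar> \<le> a j * (\<rho> / \<gamma> j) ^ j"
    using assms V_le_iff[OF \<rho>] by auto
  have "j \<in> {1..Suc m} \<longrightarrow> \<bar>R j\<bar> \<le> \<beta> j * \<rho>"
  proof (induction j)
    case (Suc j)
    show ?case
    proof (cases "j = 0")
      case True
      then show ?thesis using V(1) \<beta>_1 by simp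
    next
      case False
      show ?thesis
      proof
        assume "Suc j \<in> {1..Suc m}"
        with False have j: "j \<in> {1..m}" "j > 0" by auto
        have "\<bar>R (Suc j)\<bar> ^ j = \<bar>spow j (R (Suc j))\<bar>"
          using j by (simp add: abs_spow)
        also have "\<dots> \<le> \<bar>spow j (R j)\<bar> + \<bar>gap j R\<bar>"
          unfolding gap_def by linarith
        also have "\<dots> \<le> (\<beta> j * \<rho>) ^ j + a j * (\<rho> / \<gamma> j) ^ j"
          using j V(2)[of j] Suc by (intro add_mono) (auto simp: abs_spow intro!: power_mono)
        also have "\<dots> = (\<beta> (Suc j) * \<rho>) ^ j"
          using \<beta>_pow[OF j(1)] by (simp add: power_mult_distrib power_divide algebra_simps)
        finally show "\<bar>R (Suc j)\<bar> \<le> \<beta> (Suc j) * \<rho>"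
          using j \<rho> \<beta>_pos[of "Suc j"] by (subst (asm) power_mono_iff) auto
      qed
    qed
  qed simp
  with assms show ?thesis by blast
qed

lemma \<gamma>_pow_div:
  assumes "j \<in> {1..m}"
  shows "2 * (\<rho> / \<gamma> (Suc j)) ^ j = (2 - a j) * (\<rho> / \<gamma> j) ^ j"
proof -
  have g: "\<gamma> j ^ j > 0" "\<gamma> (Suc j) ^ j > 0" "2 * \<gamma> j ^ j = (2 - a j) * \<gamma> (Suc j) ^ j"
    using assms \<gamma>_pos[of j] \<gamma>_pos[of "Suc j"] \<gamma>_pow[OF assms] by auto
  have "2 / \<gamma> (Suc j) ^ j = (2 - a j) / \<gamma> j ^ j"
    using g by (subst frac_eq_eq) (auto simp del: power_eq_0_iff)
  then have "2 / \<gamma> (Suc j) ^ j * \<rho> ^ j = (2 - a j) / \<gamma> j ^ j * \<rho> ^ j"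
    by simp
  then show ?thesis
    by (simp add: power_divide)
qed

text \<open>Descending in \<open>j\<close>, the bound for \<open>Suc j\<close> turns into one for \<open>j\<close> by concavity of the
  root; \<open>\<gamma>\<close> is defined such that its share \<open>2 - a j\<close> and the share \<open>a j\<close> of \<open>gap j\<close> add up to 2.\<close>

lemma injection_bound:
  assumes "step s E R R'" "V R' \<le> \<rho>" "\<bar>E (Suc m)\<bar> < 2 * (\<rho> / \<gamma> (Suc m)) ^ Suc m"
  shows "j \<in> {1..Suc m} \<Longrightarrow> \<bar>spow j s - spow j (R' j)\<bar> < 2 * (\<rho> / \<gamma> j) ^ j" (is "_ \<Longrightarrow> ?P j")
    and "j \<in> {1..m} \<Longrightarrow> \<bar>spow j s - spow j (R' (Suc j))\<bar> \<le> (2 - a j) * (\<rho> / \<gamma> j) ^ j"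
proof -
  have \<rho>: "\<rho> \<ge> 0" using assms V_nonneg[of R'] by linarith
  \<comment> \<open>The exponent drops from j + 1 to j while \<open>s\<close> is still compared with
    \<open>R' (Suc j)\<close>; passing on to \<open>R' j\<close> then costs
    \<open>gap j\<close>.\<close>
  have down: "\<bar>spow j s - spow j (R' (Suc j))\<bar> < (2 - a j) * (\<rho> / \<gamma> j) ^ j"
    if "j \<in> {1..m}" "?P (Suc j)" for j
    using spow_diff_less[of j "\<rho> / \<gamma> (Suc j)" s "R' (Suc j)"] that \<rho> \<gamma>_pos[of "Suc j"]
    by (simp add: \<gamma>_pow_div del: power_Suc)
  have P: "?P j" if "j \<in> {1..Suc m}" for j
  proof -
    have "j \<le> Suc m" using that by simp
    then show ?thesis using that
    proof (induction rule: inc_induct)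
      case base
      have "E (Suc m) = spow (Suc m) s - spow (Suc m) (R' (Suc m))"
        using assms(1) by (simp add: step_def \<Lambda>_top)
      then show ?case using assms(3) by simp
    next
      case (step j)
      then have j: "j \<in> {1..m}" by simp
      have "\<bar>gap j R'\<bar> \<le> a j * (\<rho> / \<gamma> j) ^ j"
        using V_le_iff[OF \<rho>, of R'] assms(2) j by blast
      moreover have "\<bar>spow j s - spow j (R' (Suc j))\<bar> < (2 - a j) * (\<rho> / \<gamma> j) ^ j"
        using step j by (intro down) auto
      ultimately have "\<bar>spow j s - spow j (R' j)\<bar>
          < a j * (\<rho> / \<gamma> j) ^ j + (2 - a j) * (\<rho> / \<gamma> j) ^ j"
        unfolding gap_def by linarith
      then show ?case by (simp add: algebra_simps)
    qed
  qed
  show "j \<in> {1..Suc m} \<Longrightarrow> ?P j" by (rule P)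
  show "j \<in> {1..m} \<Longrightarrow> \<bar>spow j s - spow j (R' (Suc j))\<bar> \<le> (2 - a j) * (\<rho> / \<gamma> j) ^ j"
    using down[of j] P[of "Suc j"] by auto
qed

text \<open>If \<open>V = \<rho>\<close> is attained by \<open>gap j\<close>, then \<open>decay j * \<rho> ^ (j - 1)\<close> and
  \<open>drift j * \<rho> ^ (j - 1)\<close> bound the rates at which \<open>\<Lambda> j * gap j\<close> is reduced
  by its own driving term and increased by the one below.\<close>

definition decay :: "nat \<Rightarrow> real" where
  "decay j = real j * \<Lambda> j * (2 * (a j - 1) * \<Lambda> j / \<gamma> j ^ j)
     / (real (Suc j) * \<beta> (Suc j) * \<Lambda> (Suc j))"

definition drift :: "nat \<Rightarrow> real" where
  "drift j = 2 * \<Lambda> (j - 1) / \<gamma> (j - 1) ^ (j - 1)"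

text \<open>The parameter condition \<open>gain\<close> enters the Lyapunov argument here.\<close>

lemma drift_less_decay: "j \<in> {1..m} \<Longrightarrow> drift j < decay j"
  unfolding drift_def decay_def
  using gain[of j] \<beta>_pos[of "Suc j"] \<Lambda>_pos[of "Suc j"]
  by (subst pos_less_divide_eq) (auto simp: mult_ac)

text \<open>Ensures that going back from level \<rho> leads above q * \<rho>. The first condition
  serves the case that \<open>R 1\<close> attains \<open>V\<close>, the others the case of
  \<open>gap j\<close>; a common factor \<rho>^(j-1) has been cancelled, which leaves one \<rho> on
  the left.\<close>

definition admissible_rate :: "real \<Rightarrow> real \<Rightarrow> bool" where
  "admissible_rate q \<rho> \<longleftrightarrow> (q - 1) * \<rho> * \<Lambda> 1 < T * (\<Lambda> 0 - 1) \<and>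
     (\<forall>j\<in>{1..m}. a j * \<Lambda> j / \<gamma> j ^ j * \<rho> * (q ^ j - 1) < T * (decay j / q - drift j))"

lemma admissible_rate_1: "admissible_rate 1 \<rho>"
  using T_pos \<Lambda>_0 drift_less_decay by (auto simp: admissible_rate_def)

lemma admissible_rate_mono:
  assumes "admissible_rate q \<rho>" "\<rho>' \<le> \<rho>" "q \<ge> 1"
  shows "admissible_rate q \<rho>'"
proof -
  have "(q - 1) * \<rho>' * \<Lambda> 1 \<le> (q - 1) * \<rho> * \<Lambda> 1"
    using assms \<Lambda>_pos[of 1] by (intro mult_right_mono mult_left_mono) auto
  moreover have "a j * \<Lambda> j / \<gamma> j ^ j * \<rho>' * (q ^ j - 1) \<le> a j * \<Lambda> j / \<gamma> j ^ j * \<rho> * (q ^ j - 1)"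
    if "j \<in> {1..m}" for j
    using assms that \<Lambda>_pos[of j] \<gamma>_pos[of j] a_bounds[of j]
    by (intro mult_right_mono mult_left_mono) auto
  ultimately show ?thesis
    using assms(1) unfolding admissible_rate_def by fastforce
qed

text \<open>At q = 1 the left sides vanish and the inequalities are strict, so by continuity they
  survive for some larger q.\<close>

lemma ex_admissible_rate: "\<exists>q>1. admissible_rate q \<rho>"
proof -
  have 1: "\<forall>\<^sub>F q in at_right 1. (q - 1) * \<rho> * \<Lambda> 1 < T * (\<Lambda> 0 - 1)"
  proof (rule order_tendstoD)
    show "((\<lambda>q. (q - 1) * \<rho> * \<Lambda> 1) \<longlongrightarrow> (1 - 1) * \<rho> * \<Lambda> 1) (at_right 1)"
      by (intro tendsto_intros)
  qed (use T_pos \<Lambda>_0 in auto)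
  have 2: "\<forall>\<^sub>F q in at_right 1. a j * \<Lambda> j / \<gamma> j ^ j * \<rho> * (q ^ j - 1) - T * (decay j / q - drift j) < 0"
    if "j \<in> {1..m}" for j
  proof (rule order_tendstoD)
    show "((\<lambda>q. a j * \<Lambda> j / \<gamma> j ^ j * \<rho> * (q ^ j - 1) - T * (decay j / q - drift j))
        \<longlongrightarrow> a j * \<Lambda> j / \<gamma> j ^ j * \<rho> * (1 ^ j - 1) - T * (decay j / 1 - drift j)) (at_right 1)"
      by (intro tendsto_intros) auto
  qed (use T_pos drift_less_decay[OF that] in auto)
  have "\<forall>\<^sub>F q in at_right 1. \<forall>j\<in>{1..m}.
      a j * \<Lambda> j / \<gamma> j ^ j * \<rho> * (q ^ j - 1) - T * (decay j / q - drift j) < 0"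
    using 2 by (intro eventually_ball_finite) auto
  with 1 eventually_at_right_less[of 1]
  have "\<forall>\<^sub>F q in at_right 1. q > 1 \<and> admissible_rate q \<rho>"
    by eventually_elim (auto simp: admissible_rate_def)
  then show ?thesis
    by (metis (mono_tags, lifting) eventually_happens trivial_limit_at_right_real)
qed

text \<open>Whichever quantity attains \<open>V\<close>, its own driving term dominates the one
  below, so it was larger before the step. If \<open>V R\<close> were at most q * \<rho>, this
  increase would exceed what that level permits.\<close>

lemma V_expands_pos:
  assumes step: "step s E R R'" and \<rho>: "V R' = \<rho>" "\<rho> > 0"
    and top: "\<bar>E (Suc m)\<bar> < 2 * (\<rho> / \<gamma> (Suc m)) ^ Suc m"
    and q: "q \<ge> 1" "admissible_rate q \<rho>"
    and attained: "R' 1 = \<rho> \<or> (\<exists>j\<in>{1..m}. gap j R' = a j * (\<rho> / \<gamma> j) ^ j)"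
  shows "q * \<rho> < V R"
proof (rule ccontr)
  assume "\<not> ?thesis"
  then have VR: "V R \<le> q * \<rho>" by simp
  have q\<rho>: "q * \<rho> \<ge> 0" "\<rho> \<le> q * \<rho>" using q \<rho> by auto
  have upd: "\<Lambda> (Suc j) * (spow (Suc j) (R (Suc j)) - spow (Suc j) (R' (Suc j))) = T * E j"
    if "j \<le> m" for j
    using step_update[OF step that] .
  have E: "E j = \<Lambda> j * (spow j s - spow j (R' j))" if "j \<in> {1..Suc m}" for j
    using step_injection[OF step that] .
  note bounds = injection_bound[OF step _ top, unfolded \<rho>(1), OF order_refl]
  from attained show False
  proof
    assume R1: "R' 1 = \<rho>"
    \<comment> \<open>As \<open>\<gamma> 1 = 2\<close>, the injection bound for j = 1 is exactly
      \<rho>, which fixes the sign of \<open>s\<close>.\<close>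
    have "\<bar>s - \<rho>\<bar> < \<rho>"
      using bounds(1)[of 1] R1 \<gamma>_1 by simp
    then have "s > 0" by linarith
    then have "T * (\<Lambda> 0 - 1) \<le> T * E 0"
      using step_last_pos[OF step] T_pos by simp
    also have "\<dots> = \<Lambda> 1 * (R 1 - \<rho>)"
      using upd[of 0] R1 by simp
    also have "\<dots> \<le> \<Lambda> 1 * (q * \<rho> - \<rho>)"
      using abs_le_\<beta>[OF VR, of 1] \<beta>_1 \<Lambda>_pos[of 1] by (intro mult_left_mono) auto
    also have "\<dots> < T * (\<Lambda> 0 - 1)"
      using q(2) by (simp add: admissible_rate_def algebra_simps)
    finally show False by simp
  next
    assume "\<exists>j\<in>{1..m}. gap j R' = a j * (\<rho> / \<gamma> j) ^ j"
    then obtain j where j: "j \<in> {1..m}" and gap: "gap j R' = a j * (\<rho> / \<gamma> j) ^ j" by blast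
    have j0: "j > 0" using j by simp
    have \<Lambda>: "\<Lambda> j > 0" "\<Lambda> (Suc j) > 0" using \<Lambda>_pos j by auto
    have b: "\<beta> (Suc j) > 0" using \<beta>_pos j by auto
    have g: "\<gamma> j > 0" using \<gamma>_pos j by auto
    have \<rho>j: "\<rho> ^ j = \<rho> * \<rho> ^ (j - 1)" using j0 by (simp add: power_eq_if)
    \<comment> \<open>The gap has share \<open>a j\<close>, the uncertainty about \<open>s\<close>
      only 2 - \<open>a j\<close>; since \<open>a j > 1\<close>, a positive margin remains.\<close>
    have "2 * (a j - 1) * (\<rho> / \<gamma> j) ^ j = gap j R' - (2 - a j) * (\<rho> / \<gamma> j) ^ j"
      unfolding gap by (simp add: algebra_simps)
    also have "\<dots> \<le> spow j s - spow j (R' j)"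
      using bounds(2)[OF j] unfolding gap_def by linarith
    finally have Ej: "\<Lambda> j * (2 * (a j - 1) * (\<rho> / \<gamma> j) ^ j) \<le> E j"
      using \<Lambda> E[of j] j by (simp add: mult_left_mono)
    have "\<Lambda> j * (2 * (a j - 1) * (\<rho> / \<gamma> j) ^ j) > 0"
      using \<Lambda> a_bounds[OF j] \<rho> g by auto
    with Ej have "T * E j > 0" using T_pos by simp
    then have le: "R' (Suc j) \<le> R (Suc j)"
      using upd[of j] j \<Lambda> spow_mono_iff[of "Suc j" "R' (Suc j)" "R (Suc j)"]
      by (smt (verit) atLeastAtMost_iff mult_nonneg_nonpos zero_less_Suc)
    \<comment> \<open>Both states lie below the level q * \<rho>; the slope bound taken at that
      level is what divides \<open>decay j\<close> by q.\<close>
    have "V R' \<le> q * \<rho>" using q\<rho> \<rho> by simp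
    then have B: "\<bar>R (Suc j)\<bar> \<le> \<beta> (Suc j) * (q * \<rho>)" "\<bar>R' (Suc j)\<bar> \<le> \<beta> (Suc j) * (q * \<rho>)"
      using abs_le_\<beta>[OF VR, of "Suc j"] abs_le_\<beta>[of R' "q * \<rho>" "Suc j"] j by auto
    define D where "D = spow j (R (Suc j)) - spow j (R' (Suc j))"
    have "real j * (T * (\<Lambda> j * (2 * (a j - 1) * (\<rho> / \<gamma> j) ^ j))) \<le> real j * (T * E j)"
      using Ej T_pos by (intro mult_left_mono) auto
    also have "\<dots> = \<Lambda> (Suc j) * (real j * (spow (Suc j) (R (Suc j)) - spow (Suc j) (R' (Suc j))))"
      using upd[of j] j by (simp add: mult_ac)
    also have "\<dots> \<le> \<Lambda> (Suc j) * (real (Suc j) * (\<beta> (Suc j) * (q * \<rho>)) * D)"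
      using spow_diff_Suc_le[OF j0 B le] \<Lambda> unfolding D_def by (intro mult_left_mono) auto
    finally have "\<rho> * (T * \<rho> ^ (j - 1) * (real j * \<Lambda> j * (2 * (a j - 1) / \<gamma> j ^ j)))
        \<le> \<rho> * (q * D * (real (Suc j) * \<beta> (Suc j) * \<Lambda> (Suc j)))"
      by (simp add: power_divide \<rho>j mult_ac)
    then have "T * \<rho> ^ (j - 1) * (real j * \<Lambda> j * (2 * (a j - 1) / \<gamma> j ^ j))
        \<le> q * D * (real (Suc j) * \<beta> (Suc j) * \<Lambda> (Suc j))"
      using \<rho> by (simp only: mult_le_cancel_left_pos)
    then have "T * \<rho> ^ (j - 1) * (real j * \<Lambda> j * (2 * (a j - 1) / \<gamma> j ^ j))
        / (real (Suc j) * \<beta> (Suc j) * \<Lambda> (Suc j)) \<le> q * D"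
      using b \<Lambda> by (subst pos_divide_le_eq) auto
    then have "\<Lambda> j * (T * \<rho> ^ (j - 1) * (real j * \<Lambda> j * (2 * (a j - 1) / \<gamma> j ^ j))
        / (real (Suc j) * \<beta> (Suc j) * \<Lambda> (Suc j))) \<le> \<Lambda> j * (q * D)"
      using \<Lambda> by (intro mult_left_mono) auto
    then have "T * \<rho> ^ (j - 1) * decay j \<le> q * (\<Lambda> j * D)"
      unfolding decay_def by (simp add: mult_ac)
    then have up: "T * \<rho> ^ (j - 1) * (decay j / q) \<le> \<Lambda> j * D"
      using q by (simp add: pos_divide_le_eq mult_ac)
    \<comment> \<open>For j = 1 the term below is the discontinuous injection:
      \<open>drift 1 = 2 * \<Lambda> 0\<close> exceeds \<open>\<Lambda> 0 + 1\<close> because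
      \<open>\<Lambda> 0 > 1\<close>.\<close>
    have "E (j - 1) \<le> drift j * \<rho> ^ (j - 1)"
    proof (cases "j = 1")
      case True
      then show ?thesis
        using step_last[OF step] \<Lambda>_0 by (simp add: drift_def)
    next
      case False
      then have j1: "j - 1 \<in> {1..Suc m}" using j by auto
      have "E (j - 1) \<le> \<Lambda> (j - 1) * (2 * (\<rho> / \<gamma> (j - 1)) ^ (j - 1))"
        unfolding E[OF j1] using less_imp_le[OF abs_less_iff[THEN iffD1, OF bounds(1)[OF j1], THEN conjunct1]]
          \<Lambda>_pos[of "j - 1"] j1
        by (intro mult_left_mono) auto
      then show ?thesis by (simp add: drift_def power_divide mult_ac)
    qed
    then have "T * E (j - 1) \<le> T * (drift j * \<rho> ^ (j - 1))"
      using T_pos by (intro mult_left_mono) auto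
    then have "\<Lambda> j * (spow j (R j) - spow j (R' j)) \<le> T * (drift j * \<rho> ^ (j - 1))"
      using upd[of "j - 1"] j by auto
    with up have "T * \<rho> ^ (j - 1) * (decay j / q - drift j) \<le> \<Lambda> j * (gap j R - gap j R')"
      unfolding gap_def D_def by (simp add: algebra_simps)
    moreover have "a j * \<Lambda> j * (\<rho> / \<gamma> j) ^ j * (q ^ j - 1) < T * \<rho> ^ (j - 1) * (decay j / q - drift j)"
    proof -
      have "\<rho> ^ (j - 1) * (a j * \<Lambda> j / \<gamma> j ^ j * \<rho> * (q ^ j - 1))
          < \<rho> ^ (j - 1) * (T * (decay j / q - drift j))"
        using q(2) j \<rho> unfolding admissible_rate_def by (intro mult_strict_left_mono) auto
      then show ?thesis by (simp add: power_divide \<rho>j mult_ac)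
    qed
    ultimately have "\<Lambda> j * (a j * (\<rho> / \<gamma> j) ^ j * (q ^ j - 1)) < \<Lambda> j * (gap j R - gap j R')"
      by (simp add: mult_ac)
    then have "a j * (\<rho> / \<gamma> j) ^ j * (q ^ j - 1) < gap j R - gap j R'"
      using \<Lambda> by (simp only: mult_less_cancel_left_pos)
    moreover have "gap j R \<le> a j * (q * \<rho> / \<gamma> j) ^ j"
      using V_le_iff[OF q\<rho>(1), of R] VR j by force
    moreover have "a j * (q * \<rho> / \<gamma> j) ^ j
        = a j * (\<rho> / \<gamma> j) ^ j + a j * (\<rho> / \<gamma> j) ^ j * (q ^ j - 1)"
      by (simp add: power_divide power_mult_distrib algebra_simps diff_divide_distrib)
    ultimately show False
      unfolding gap by linarith
  qed
qed

lemma V_expands: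
  assumes step: "step s E R R'" and \<rho>: "V R' = \<rho>" "\<rho> > 0"
    and top: "\<bar>E (Suc m)\<bar> < 2 * (\<rho> / \<gamma> (Suc m)) ^ Suc m"
    and q: "q \<ge> 1" "admissible_rate q \<rho>"
  shows "q * \<rho> < V R"
proof -
  consider "R' 1 = \<rho> \<or> (\<exists>j\<in>{1..m}. gap j R' = a j * (\<rho> / \<gamma> j) ^ j)"
    | "- R' 1 = \<rho> \<or> (\<exists>j\<in>{1..m}. - gap j R' = a j * (\<rho> / \<gamma> j) ^ j)"
    using V_attained[of R'] unfolding \<rho>(1) by (metis abs_if)
  then show ?thesis
  proof cases
    case 1
    then show ?thesis using V_expands_pos[OF step \<rho> top q] by blast
  next
    case 2
    then show ?thesis
      using V_expands_pos[OF step_uminus[OF step], of \<rho> q] \<rho> top q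
      by (simp add: V_uminus gap_uminus)
  qed
qed

section \<open>Decay of V down to the noise level\<close>

lemma V_contracts:
  assumes step: "step s E R R'" and \<rho>: "\<rho> \<ge> 0"
    and top: "\<bar>E (Suc m)\<bar> \<le> 2 * (\<rho> / \<gamma> (Suc m)) ^ Suc m"
    and q: "q \<ge> 1" "admissible_rate q C" and C: "V R \<le> C"
  shows "V R' \<le> max \<rho> (V R / q)"
proof (cases "V R' \<le> \<rho>")
  case False
  then have "(\<rho> / \<gamma> (Suc m)) ^ Suc m < (V R' / \<gamma> (Suc m)) ^ Suc m"
    using \<rho> \<gamma>_pos[of "Suc m"] by (intro power_strict_mono divide_strict_right_mono) auto
  then have top': "\<bar>E (Suc m)\<bar> < 2 * (V R' / \<gamma> (Suc m)) ^ Suc m"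
    using top by linarith
  have pos: "V R' > 0" using False \<rho> by linarith
  \<comment> \<open>The rate 1 is admissible at every level and shows that \<open>V R'\<close> stays
    below C; only then is q known to be admissible at \<open>V R'\<close>.\<close>
  have "V R' < V R"
    using V_expands[OF step refl pos top', of 1] admissible_rate_1 by simp
  then have "admissible_rate q (V R')"
    using admissible_rate_mono[OF q(2) _ q(1)] C by simp
  then have "q * V R' < V R"
    using V_expands[OF step refl pos top' q(1)] by simp
  then show ?thesis
    using q(1) by (simp add: le_max_iff_disj pos_le_divide_eq mult.commute)
qed simp

text \<open>K depends on the trajectory only through the bound C on its initial value. The
  \<epsilon> is there because geometric decay alone does not reach \<rho> = 0.\<close>

lemma V_eventually_le:
  assumes \<rho>: "\<rho> \<ge> 0" and \<epsilon>: "\<epsilon> > 0"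
  shows "\<exists>K\<ge>1. \<forall>R s E. V (R 1) \<le> C \<longrightarrow> (\<forall>k\<ge>1. step (s k) (E k) (R k) (R (Suc k))) \<longrightarrow>
     (\<forall>k\<ge>1. \<bar>E k (Suc m)\<bar> \<le> 2 * (\<rho> / \<gamma> (Suc m)) ^ Suc m) \<longrightarrow>
     (\<forall>k\<ge>K. V (R k) \<le> max \<rho> \<epsilon>)"
proof -
  \<comment> \<open>Including \<rho> makes the sublevel set forward invariant even when the start
    lies below the noise level.\<close>
  define C' where "C' = max C \<rho>"
  obtain q where q: "q > 1" "admissible_rate q C'"
    using ex_admissible_rate by blast
  have C': "C' \<ge> 0" "\<rho> \<le> C'" using \<rho> by (auto simp: C'_def)
  have "(\<lambda>k. C' * (1 / q) ^ k) \<longlonglongrightarrow> C' * 0"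
    using q by (intro tendsto_mult tendsto_const LIMSEQ_realpow_zero) auto
  then have "\<forall>\<^sub>F k in sequentially. C' * (1 / q) ^ k < \<epsilon>"
    using \<epsilon> by (intro order_tendstoD) auto
  then obtain K where K: "\<And>k. k \<ge> K \<Longrightarrow> C' * (1 / q) ^ k < \<epsilon>"
    by (auto simp: eventually_sequentially)
  show ?thesis
  proof (intro exI[of _ "Suc K"] conjI allI impI)
    fix R s E k
    assume R1: "V (R 1) \<le> C" and st: "\<forall>k\<ge>1. step (s k) (E k) (R k) (R (Suc k))"
      and top: "\<forall>k\<ge>1. \<bar>E k (Suc m)\<bar> \<le> 2 * (\<rho> / \<gamma> (Suc m)) ^ Suc m"
      and k: "Suc K \<le> k"
    have dec: "V (R (Suc k)) \<le> max \<rho> (C' * (1 / q) ^ k)" for k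
    proof (induction k)
      case 0
      then show ?case using R1 by (auto simp: C'_def)
    next
      case (Suc k)
      have "C' * (1 / q) ^ k \<le> C' * 1"
        using C' q by (intro mult_left_mono power_le_one) auto
      then have "V (R (Suc k)) \<le> C'"
        using Suc C' by simp
      then have "V (R (Suc (Suc k))) \<le> max \<rho> (V (R (Suc k)) / q)"
        using V_contracts[of "s (Suc k)" "E (Suc k)" "R (Suc k)" _ \<rho>, OF _ \<rho> _ _ q(2)] st top q(1)
        by simp
      also have "\<dots> \<le> max \<rho> (max \<rho> (C' * (1 / q) ^ k) / q)"
        using Suc q by (intro max.mono divide_right_mono) auto
      also have "\<dots> \<le> max \<rho> (C' * (1 / q) ^ Suc k)"
      proof -
        have "\<rho> / q \<le> \<rho> / 1" using q \<rho> by (intro divide_left_mono) auto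
        then show ?thesis by (auto simp: max_def)
      qed
      finally show ?case .
    qed
    obtain l where l: "k = Suc l" "l \<ge> K" using k by (cases k) auto
    show "V (R k) \<le> max \<rho> \<epsilon>"
      using dec[of l] K[OF l(2)] l(1) by (auto simp: max_def split: if_splits)
  qed simp
qed

section \<open>Sliding near the origin and exact convergence\<close>

text \<open>For positive \<open>s\<close> the last state moves by a fixed amount. Starting from a
  small \<open>R 1\<close>, this makes \<open>R' 1\<close> so negative that \<open>E 1\<close> is
  large, and component 2 would move by more than two small values allow.\<close>

lemma not_step_pos:
  assumes step: "step s E R R'" and V: "V R \<le> \<rho>" "V R' \<le> \<rho>"
    and small: "\<Lambda> 1 * \<rho> \<le> T / 2 * (\<Lambda> 0 - 1)" "\<Lambda> 2 * (\<beta> 2 * \<rho>)\<^sup>2 \<le> T\<^sup>2 / 4 * (\<Lambda> 0 - 1)"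
  shows "\<not> s > 0"
proof
  assume s: "s > 0"
  have \<Lambda>: "\<Lambda> 1 > 0" "\<Lambda> 2 > 0" using \<Lambda>_pos[of 1] \<Lambda>_pos[of 2] m_pos by auto
  have "T * (\<Lambda> 0 - 1) \<le> T * E 0"
    using step_last_pos[OF step s] T_pos by simp
  also have "\<dots> = \<Lambda> 1 * (R 1 - R' 1)"
    using step_update[OF step, of 0] by simp
  also have "\<dots> \<le> \<Lambda> 1 * (\<rho> - R' 1)"
    using abs_le_\<beta>[OF V(1), of 1] \<beta>_1 \<Lambda> by (intro mult_left_mono) auto
  finally have "T / 2 * (\<Lambda> 0 - 1) \<le> - \<Lambda> 1 * R' 1"
    using small(1) by (simp add: algebra_simps)
  also have "\<dots> < \<Lambda> 1 * (s - R' 1)"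
    using s \<Lambda> by (simp add: algebra_simps)
  also have "\<dots> = E 1"
    using step_injection[OF step, of 1] by simp
  finally have "T * (T / 2 * (\<Lambda> 0 - 1)) < T * E 1"
    using T_pos by simp
  also have "\<dots> = \<Lambda> 2 * (spow 2 (R 2) - spow 2 (R' 2))"
    using step_update[OF step, of 1] m_pos by (simp add: numeral_2_eq_2)
  also have "\<dots> \<le> \<Lambda> 2 * (2 * (\<beta> 2 * \<rho>)\<^sup>2)"
  proof -
    have "\<bar>spow 2 (R 2)\<bar> \<le> (\<beta> 2 * \<rho>)\<^sup>2" "\<bar>spow 2 (R' 2)\<bar> \<le> (\<beta> 2 * \<rho>)\<^sup>2"
      using power_mono[OF abs_le_\<beta>[OF V(1), of 2], of 2] power_mono[OF abs_le_\<beta>[OF V(2), of 2], of 2] m_pos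
      by (simp_all add: abs_spow)
    then show ?thesis using \<Lambda> by (intro mult_left_mono) auto
  qed
  also have "\<dots> \<le> T * (T / 2 * (\<Lambda> 0 - 1))"
    using small(2) by (simp add: power2_eq_square algebra_simps)
  finally show False by simp
qed

lemma sliding_if_small:
  assumes "step s E R R'" and "V R \<le> \<rho>" "V R' \<le> \<rho>"
    and "\<Lambda> 1 * \<rho> \<le> T / 2 * (\<Lambda> 0 - 1)" "\<Lambda> 2 * (\<beta> 2 * \<rho>)\<^sup>2 \<le> T\<^sup>2 / 4 * (\<Lambda> 0 - 1)"
  shows "s = 0"
  using not_step_pos[OF assms] not_step_pos[OF step_uminus[OF assms(1)], of \<rho>] assms(2-)
  by (force simp: V_uminus)

lemma ex_small: "\<exists>\<epsilon>>0. \<Lambda> 1 * \<epsilon> \<le> T / 2 * (\<Lambda> 0 - 1) \<and> \<Lambda> 2 * (\<beta> 2 * \<epsilon>)\<^sup>2 \<le> T\<^sup>2 / 4 * (\<Lambda> 0 - 1)"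
proof -
  have 1: "\<forall>\<^sub>F \<epsilon> in at_right 0. \<Lambda> 1 * \<epsilon> < T / 2 * (\<Lambda> 0 - 1)"
  proof (rule order_tendstoD)
    show "((\<lambda>\<epsilon>. \<Lambda> 1 * \<epsilon>) \<longlongrightarrow> \<Lambda> 1 * 0) (at_right 0)" by (intro tendsto_intros)
  qed (use T_pos \<Lambda>_0 in auto)
  have 2: "\<forall>\<^sub>F \<epsilon> in at_right 0. \<Lambda> 2 * (\<beta> 2 * \<epsilon>)\<^sup>2 < T\<^sup>2 / 4 * (\<Lambda> 0 - 1)"
  proof (rule order_tendstoD)
    show "((\<lambda>\<epsilon>. \<Lambda> 2 * (\<beta> 2 * \<epsilon>)\<^sup>2) \<longlongrightarrow> \<Lambda> 2 * (\<beta> 2 * 0)\<^sup>2) (at_right 0)" by (intro tendsto_intros)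
  qed (use T_pos \<Lambda>_0 in auto)
  from 1 2 eventually_at_right_less[of 0]
  have "\<forall>\<^sub>F \<epsilon> in at_right 0. \<epsilon> > 0 \<and> \<Lambda> 1 * \<epsilon> \<le> T / 2 * (\<Lambda> 0 - 1)
      \<and> \<Lambda> 2 * (\<beta> 2 * \<epsilon>)\<^sup>2 \<le> T\<^sup>2 / 4 * (\<Lambda> 0 - 1)"
    by eventually_elim auto
  then show ?thesis
    by (metis (mono_tags, lifting) eventually_happens trivial_limit_at_right_real)
qed

text \<open>With \<open>s = 0\<close> and no noise the injection relation for the top index gives
  \<open>R (Suc m) = 0\<close>. Once component j + 1 is zero at two successive times, its update
  forces \<open>E j = 0\<close>, and component j vanishes one step later.\<close>

lemma V_zero_after_sliding:
  assumes st: "\<forall>k\<ge>1. step (s k) (E k) (R k) (R (Suc k))" and top: "\<forall>k\<ge>1. E k (Suc m) = 0"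
    and s: "\<forall>k\<ge>K. s k = 0" and K: "K \<ge> 1" and k: "k \<ge> K + Suc m"
  shows "V (R k) = 0"
proof -
  have "R (Suc k) j = 0" if "j \<in> {1..Suc m}" "k \<ge> K + (Suc m - j)" for j k
  proof -
    have "j \<le> Suc m" using that by simp
    then have "j \<ge> 1 \<longrightarrow> (\<forall>k\<ge>K + (Suc m - j). R (Suc k) j = 0)"
    proof (induction rule: inc_induct)
      case base
      have "R (Suc k) (Suc m) = 0" if "k \<ge> K" for k
      proof -
        have "spow (Suc m) (R (Suc k) (Suc m)) = 0"
          using st top s that K unfolding step_def
          by (metis (no_types, opaque_lifting) \<Lambda>_top atLeastAtMost_iff diff_0 le_add1 le_trans
              mult_1 neg_equal_0_iff_equal order_refl plus_1_eq_Suc spow_zero)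
        then show ?thesis using abs_spow[of "Suc m" "R (Suc k) (Suc m)"] by auto
      qed
      then show ?case by simp
    next
      case (step j)
      show ?case
      proof (intro impI allI)
        fix k assume j: "1 \<le> j" and k: "K + (Suc m - j) \<le> k"
        have jm: "j \<in> {1..m}" using j step by simp
        \<comment> \<open>The induction hypothesis is needed at k - 1 and at k, hence the delay of
          one step per component.\<close>
        have "k - 1 \<ge> K + (Suc m - Suc j)" "k \<ge> K + (Suc m - Suc j)" "Suc (k - 1) = k" "k \<ge> K"
          using k jm K by auto
        then have R0: "R k (Suc j) = 0" "R (Suc k) (Suc j) = 0"
          using step.IH by (metis le_add1 plus_1_eq_Suc)+
        have sk: "step (s k) (E k) (R k) (R (Suc k))" "s k = 0"
          using st s \<open>k \<ge> K\<close> K le_trans[OF K \<open>k \<ge> K\<close>] by blast+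
        have "T * E k j = 0"
          using sk(1) R0 jm unfolding step_def by (metis atLeastAtMost_iff cancel_comm_monoid_add_class.diff_cancel mult_zero_right)
        moreover have "E k j = - \<Lambda> j * spow j (R (Suc k) j)"
          using sk jm unfolding step_def by simp
        ultimately have "spow j (R (Suc k) j) = 0"
          using T_pos \<Lambda>_pos[of j] jm by simp
        then show "R (Suc k) j = 0"
          using abs_spow[of j "R (Suc k) j"] j by simp
      qed
    qed
    then show ?thesis using that by simp
  qed
  note Suc_zero = this
  obtain l where l: "k = Suc l" using k by (cases k) auto
  have R0: "R k j = 0" if "j \<in> {1..Suc m}" for j
    unfolding l using that k l by (intro Suc_zero) auto
  have "V (R k) \<le> 0"
    using R0 a_bounds by (subst V_le_iff) (fastforce simp: gap_def power_0_left)+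
  then show ?thesis using V_nonneg[of "R k"] by linarith
qed

text \<open>For positive \<rho> the choice \<epsilon> = \<rho> suffices. For \<rho> = 0, decay to a
  small \<epsilon> enforces sliding, and m + 1 further steps bring the error to zero.\<close>

lemma finite_time_convergence:
  assumes \<rho>: "\<rho> \<ge> 0"
  shows "\<exists>K\<ge>1. \<forall>R s E. V (R 1) \<le> C \<longrightarrow> (\<forall>k\<ge>1. step (s k) (E k) (R k) (R (Suc k))) \<longrightarrow>
     (\<forall>k\<ge>1. \<bar>E k (Suc m)\<bar> \<le> 2 * (\<rho> / \<gamma> (Suc m)) ^ Suc m) \<longrightarrow>
     (\<forall>k\<ge>K. V (R k) \<le> \<rho>)"
proof (cases "\<rho> = 0")
  case False
  then show ?thesis
    using V_eventually_le[of \<rho> \<rho> C] \<rho> by simp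
next
  case True
  obtain \<epsilon> where \<epsilon>: "\<epsilon> > 0" "\<Lambda> 1 * \<epsilon> \<le> T / 2 * (\<Lambda> 0 - 1)"
      "\<Lambda> 2 * (\<beta> 2 * \<epsilon>)\<^sup>2 \<le> T\<^sup>2 / 4 * (\<Lambda> 0 - 1)"
    using ex_small by blast
  obtain K where K: "K \<ge> 1" "\<And>R s E. V (R 1) \<le> C \<Longrightarrow>
      (\<forall>k\<ge>1. step (s k) (E k) (R k) (R (Suc k))) \<Longrightarrow>
      (\<forall>k\<ge>1. \<bar>E k (Suc m)\<bar> \<le> 2 * (\<rho> / \<gamma> (Suc m)) ^ Suc m) \<Longrightarrow>
      (\<forall>k\<ge>K. V (R k) \<le> max \<rho> \<epsilon>)"
    using V_eventually_le[OF \<rho> \<epsilon>(1), of C] by metis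
  show ?thesis
  proof (intro exI[of _ "K + Suc m"] conjI allI impI)
    fix R s E k
    assume *: "V (R 1) \<le> C" "\<forall>k\<ge>1. step (s k) (E k) (R k) (R (Suc k))"
      "\<forall>k\<ge>1. \<bar>E k (Suc m)\<bar> \<le> 2 * (\<rho> / \<gamma> (Suc m)) ^ Suc m" and k: "K + Suc m \<le> k"
    have small: "V (R k) \<le> \<epsilon>" if "k \<ge> K" for k
      using K(2)[OF *] that True \<epsilon> by simp
    have "\<forall>k\<ge>K. s k = 0"
      using sliding_if_small[OF _ small small \<epsilon>(2,3)] *(2) K(1) by (metis le_SucI le_trans)
    moreover have "\<forall>k\<ge>1. E k (Suc m) = 0"
      using *(3) True by simp
    ultimately show "V (R k) \<le> \<rho>"
      using V_zero_after_sliding[OF *(2) _ _ K(1) k] True by simp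
  qed simp
qed

end

section \<open>Lipschitz functions with almost everywhere bounded derivative\<close>

text \<open>Supremum argument: the set of points satisfying the bound contains its supremum, by
  continuity of h and monotonicity of \<phi>, and a supremum below b could be pushed further by
  \<open>growth\<close>.\<close>

lemma le_of_right_growth:
  fixes h :: "real \<Rightarrow> real"
  assumes "a \<le> b" and cont: "continuous_on {a..b} h"
    and mono: "mono_on {a..b} \<phi>"
    and growth: "\<And>x. \<lbrakk>a \<le> x; x < b\<rbrakk> \<Longrightarrow>
       \<exists>\<delta>>0. \<forall>t\<in>{x..x + \<delta>}. t \<le> b \<longrightarrow> h t - h x \<le> \<phi> t - \<phi> x"
  shows "h b - h a \<le> \<phi> b - \<phi> a"
proof -
  define S where "S = {x\<in>{a..b}. h x - h a \<le> \<phi> x - \<phi> a}"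
  have aS: "a \<in> S" using assms by (simp add: S_def)
  have bdd: "bdd_above S" unfolding S_def by (rule bdd_aboveI[of _ b]) auto
  define x where "x = Sup S"
  have x: "a \<le> x" "x \<le> b"
  proof -
    show "a \<le> x" unfolding x_def using aS bdd by (rule cSup_upper)
    show "x \<le> b" unfolding x_def by (rule cSup_least) (use aS in \<open>auto simp: S_def\<close>)
  qed
  have xS: "x \<in> S"
  proof -
    obtain X where X: "\<And>n. X n \<in> S" "X \<longlonglongrightarrow> x"
      using closure_contains_Sup[OF _ bdd] aS unfolding x_def closure_sequential by blast
    have Xb: "X n \<in> {a..b}" for n using X(1)[of n] by (simp add: S_def)
    have "X n \<le> x" for n using X(1)[of n] bdd unfolding x_def by (rule cSup_upper)
    then have "\<phi> (X n) \<le> \<phi> x" for n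
      using mono Xb x by (auto simp: mono_on_def)
    then have "h (X n) - h a \<le> \<phi> x - \<phi> a" for n
      using X(1)[of n] by (smt (verit) S_def mem_Collect_eq)
    moreover have "(\<lambda>n. h (X n)) \<longlonglongrightarrow> h x"
      using cont X(2) Xb x by (auto simp: continuous_on_sequentially comp_def)
    ultimately have "h x - h a \<le> \<phi> x - \<phi> a"
      by (intro LIMSEQ_le_const2[of "\<lambda>n. h (X n) - h a"] tendsto_intros) auto
    then show ?thesis using x by (simp add: S_def)
  qed
  have "x = b"
  proof (rule ccontr)
    assume "x \<noteq> b"
    then obtain \<delta> where \<delta>: "\<delta> > 0" "\<And>t. t \<in> {x..x + \<delta>} \<Longrightarrow> t \<le> b \<Longrightarrow> h t - h x \<le> \<phi> t - \<phi> x"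
      using growth[of x] x by force
    define t where "t = min b (x + \<delta>)"
    have "x < t" "t \<le> b" "t \<in> {x..x + \<delta>}" using \<delta> x \<open>x \<noteq> b\<close> by (auto simp: t_def)
    then have "t \<in> S"
      using \<delta>(2)[of t] xS x by (auto simp: S_def)
    then have "t \<le> x" using bdd unfolding x_def by (rule cSup_upper)
    with \<open>x < t\<close> show False by simp
  qed
  then show ?thesis using xS by (simp add: S_def)
qed

text \<open>The exceptional null set is covered by an open set of small measure; there the
  Lipschitz constant \<open>C\<close> bounds the growth instead of \<open>L\<close>.\<close>

lemma lipschitz_AE_deriv_increment:
  fixes h :: "real \<Rightarrow> real"
  assumes lip: "C-lipschitz_on {a..b} h" and "a \<le> b" and "negligible E"
    and deriv: "\<And>x. x \<in> {a..<b} - E \<Longrightarrow> \<exists>D. (h has_real_derivative D) (at_right x) \<and> D \<le> L"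
    and "L \<ge> 0"
  shows "h b - h a \<le> L * (b - a)"
proof (rule field_le_epsilon)
  fix e :: real assume "e > 0"
  have "C \<ge> 0" using lip by (rule lipschitz_on_nonneg)
  \<comment> \<open>The two error contributions will be \<epsilon> * (b - a) and C * \<epsilon>; the
    summand 1 keeps the denominator positive.\<close>
  define \<epsilon> where "\<epsilon> = e / (b - a + C + 1)"
  have pos: "b - a + C + 1 > 0" using \<open>a \<le> b\<close> \<open>C \<ge> 0\<close> by simp
  then have \<epsilon>: "\<epsilon> > 0" using \<open>e > 0\<close> by (simp add: \<epsilon>_def)
  have "E \<in> sets lebesgue" using \<open>negligible E\<close> by (simp add: negligible_imp_sets)
  then obtain U where U: "open U" "E \<subseteq> U" "U - E \<in> lmeasurable" "emeasure lebesgue (U - E) < ennreal \<epsilon>"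
    using sets_lebesgue_outer_open[OF _ \<epsilon>] by metis
  have neg: "emeasure lebesgue E = 0"
    using negligible_iff_emeasure0[OF \<open>E \<in> sets lebesgue\<close>] \<open>negligible E\<close> by blast
  have "emeasure lebesgue ((U - E) \<union> E) \<le> emeasure lebesgue (U - E) + emeasure lebesgue E"
    using U(3) \<open>E \<in> sets lebesgue\<close> by (intro emeasure_subadditive) auto
  moreover have "(U - E) \<union> E = U" using U(2) by blast
  ultimately have "emeasure lebesgue U \<le> emeasure lebesgue (U - E) + emeasure lebesgue E" by simp
  then have U_less: "emeasure lebesgue U < ennreal \<epsilon>" using U neg by simp
  then have "U \<in> lmeasurable"
    using U(1) by (auto simp: fmeasurable_def borel_open intro: less_trans)
  moreover from this U_less have "measure lebesgue U < \<epsilon>"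
    using emeasure_eq_measure2[of U lebesgue] by (simp add: ennreal_less_iff)
  ultimately have Um: "U \<in> lmeasurable" "measure lebesgue U < \<epsilon>" by auto
  define w where "w t = measure lebesgue (U \<inter> {a..t})" for t
  have int_m: "U \<inter> {a..t} \<in> lmeasurable" for t
    using Um by (intro fmeasurable.Int) auto
  \<comment> \<open>Slope L + \<epsilon> covers the points with a bounded derivative; crossing a
    piece of \<open>U\<close> pays C times its length on top, in total at most C *
    \<epsilon>.\<close>
  define \<phi> where "\<phi> t = (L + \<epsilon>) * t + C * w t" for t
  have w_mono: "w s \<le> w t" if "s \<le> t" for s t
    unfolding w_def using int_m that by (intro measure_mono_fmeasurable) (auto simp: fmeasurableD)
  have "h b - h a \<le> \<phi> b - \<phi> a"
  proof (rule le_of_right_growth)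
    show "mono_on {a..b} \<phi>"
      unfolding \<phi>_def using w_mono \<epsilon> \<open>C \<ge> 0\<close> \<open>L \<ge> 0\<close>
      by (auto intro!: mono_onI add_mono mult_left_mono)
    show "continuous_on {a..b} h" using lip by (rule lipschitz_on_continuous_on)
    fix x assume x: "a \<le> x" "x < b"
    show "\<exists>\<delta>>0. \<forall>t\<in>{x..x + \<delta>}. t \<le> b \<longrightarrow> h t - h x \<le> \<phi> t - \<phi> x"
    proof (cases "x \<in> E")
      case True
      then obtain \<delta> where \<delta>: "\<delta> > 0" "cball x \<delta> \<subseteq> U"
        using U by (meson open_contains_cball subset_iff)
      have "h t - h x \<le> \<phi> t - \<phi> x" if "t \<in> {x..x + \<delta>}" "t \<le> b" for t
      proof -
        have sub: "{x..t} \<subseteq> U"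
          using \<delta> that by (force simp: dist_real_def)
        have ivl: "{x<..t} \<in> lmeasurable"
          using that by (auto simp: fmeasurable_def)
        have "w x + (t - x) = measure lebesgue (U \<inter> {a..x}) + measure lebesgue {x<..t}"
          using that by (simp add: w_def)
        also have "\<dots> = measure lebesgue (U \<inter> {a..x} \<union> {x<..t})"
          using int_m ivl by (intro measure_Un_AE[symmetric]) auto
        also have "\<dots> \<le> w t"
          unfolding w_def using sub that x int_m ivl by (intro measure_mono_fmeasurable) (auto simp: fmeasurableD)
        finally have "C * (t - x) \<le> C * (w t - w x)"
          using \<open>C \<ge> 0\<close> by (intro mult_left_mono) auto
        moreover have "h t - h x \<le> C * (t - x)"
          using lipschitz_onD[OF lip, of t x] x that by (auto simp: dist_real_def)
        moreover have "(L + \<epsilon>) * x \<le> (L + \<epsilon>) * t"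
          using that \<epsilon> \<open>L \<ge> 0\<close> by (intro mult_left_mono) auto
        ultimately show ?thesis
          unfolding \<phi>_def by (simp add: algebra_simps)
      qed
      with \<delta> show ?thesis by blast
    next
      case False
      then obtain D where D: "(h has_real_derivative D) (at_right x)" "D \<le> L"
        using deriv[of x] x by auto
      have "((\<lambda>t. (h t - h x) / (t - x)) \<longlongrightarrow> D) (at_right x)"
        using D(1) by (simp add: has_field_derivative_iff)
      then have "\<forall>\<^sub>F t in at_right x. (h t - h x) / (t - x) < L + \<epsilon>"
        using D(2) \<epsilon> by (intro order_tendstoD) auto
      then obtain \<delta>' where \<delta>': "\<delta>' > x"
          "\<And>t. x < t \<Longrightarrow> t < \<delta>' \<Longrightarrow> (h t - h x) / (t - x) < L + \<epsilon>"
        by (auto simp: eventually_at_right_field)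
      define \<delta> where "\<delta> = (\<delta>' - x) / 2"
      have "h t - h x \<le> \<phi> t - \<phi> x" if "t \<in> {x..x + \<delta>}" "t \<le> b" for t
      proof (cases "t = x")
        case False
        then have "t > x" "t < \<delta>'" using that \<delta>'(1) by (auto simp: \<delta>_def field_simps)
        then have "h t - h x \<le> (L + \<epsilon>) * (t - x)"
          using \<delta>'(2)[of t] by (simp add: pos_divide_less_eq)
        moreover have "C * w x \<le> C * w t"
          using w_mono \<open>t > x\<close> \<open>C \<ge> 0\<close> by (intro mult_left_mono) auto
        ultimately show ?thesis unfolding \<phi>_def by (simp add: algebra_simps)
      qed simp
      moreover have "\<delta> > 0" using \<delta>'(1) by (simp add: \<delta>_def)
      ultimately show ?thesis by blast
    qed
  qed (use \<open>a \<le> b\<close> in auto)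
  also have "\<phi> b - \<phi> a \<le> (L + \<epsilon>) * (b - a) + C * \<epsilon>"
  proof -
    have "w b \<le> measure lebesgue U"
      unfolding w_def using int_m Um by (intro measure_mono_fmeasurable) (auto simp: fmeasurableD)
    then have "w b - w a \<le> \<epsilon>"
      using Um measure_nonneg[of lebesgue "U \<inter> {a..a}"] unfolding w_def by linarith
    then have "C * (w b - w a) \<le> C * \<epsilon>"
      using \<open>C \<ge> 0\<close> by (rule mult_left_mono)
    then show ?thesis unfolding \<phi>_def by (simp add: algebra_simps)
  qed
  also have "\<dots> \<le> L * (b - a) + e"
  proof -
    have "\<epsilon> * (b - a + C) \<le> \<epsilon> * (b - a + C + 1)" using \<epsilon> by simp
    also have "\<dots> = e" using pos by (simp add: \<epsilon>_def)
    finally show ?thesis by (simp add: algebra_simps)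
  qed
  finally show "h b - h a \<le> L * (b - a) + e" .
qed

text \<open>A signal comes with some Lipschitz constant, while the estimates need L itself. The
  increment bound is applied to h and to its negative.\<close>

lemma lipschitz_of_AE_deriv_bound:
  fixes h :: "real \<Rightarrow> real"
  assumes lip: "C-lipschitz_on {0..} h" and "L \<ge> 0"
    and ae: "AE t in lebesgue_on {0..}.
        h differentiable (at t within {0..}) \<and> \<bar>vector_derivative h (at t within {0..})\<bar> \<le> L"
  shows "L-lipschitz_on {0..} h"
proof -
  have "AE t in lebesgue. t \<in> {0..} \<longrightarrow>
      h differentiable (at t within {0..}) \<and> \<bar>vector_derivative h (at t within {0..})\<bar> \<le> L"
    using ae by (subst (asm) AE_restrict_space_iff) auto
  then obtain E where E: "negligible E" "\<And>t. t \<ge> 0 \<Longrightarrow> t \<notin> E \<Longrightarrow>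
      h differentiable (at t within {0..}) \<and> \<bar>vector_derivative h (at t within {0..})\<bar> \<le> L"
    unfolding eventually_ae_filter negligible_iff_null_sets by auto
  have deriv: "\<exists>D. (h has_real_derivative D) (at_right t) \<and> \<bar>D\<bar> \<le> L" if "t \<ge> 0" "t \<notin> E" for t
  proof -
    have "(h has_real_derivative vector_derivative h (at t within {0..})) (at t within {0..})"
      using E(2)[OF that] by (simp add: has_real_derivative_iff_has_vector_derivative vector_derivative_works)
    then have "(h has_real_derivative vector_derivative h (at t within {0..})) (at_right t)"
      by (rule has_field_derivative_subset) (use that in auto)
    then show ?thesis using E(2)[OF that] by blast
  qed
  have inc: "\<bar>h t - h s\<bar> \<le> L * (t - s)" if st: "0 \<le> s" "s \<le> t" for s t
  proof -
    have l: "C-lipschitz_on {s..t} h"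
      using lip by (rule lipschitz_on_subset) (use that in auto)
    have "h t - h s \<le> L * (t - s)"
    proof (rule lipschitz_AE_deriv_increment[OF l _ E(1)])
      fix x assume "x \<in> {s..<t} - E"
      then show "\<exists>D. (h has_real_derivative D) (at_right x) \<and> D \<le> L"
        using deriv[of x] that by fastforce
    qed (use that \<open>L \<ge> 0\<close> in auto)
    moreover have "- h t - (- h s) \<le> L * (t - s)"
    proof (rule lipschitz_AE_deriv_increment[OF _ _ E(1)])
      show "C-lipschitz_on {s..t} (\<lambda>t. - h t)" using l by simp
      fix x assume x: "x \<in> {s..<t} - E"
      then obtain D where D: "(h has_real_derivative D) (at_right x)" "\<bar>D\<bar> \<le> L"
        using deriv[of x] st by auto
      then show "\<exists>D. ((\<lambda>t. - h t) has_real_derivative D) (at_right x) \<and> D \<le> L"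
        by (intro exI[of _ "- D"]) (auto intro: DERIV_minus)
    qed (use that \<open>L \<ge> 0\<close> in auto)
    ultimately show ?thesis by linarith
  qed
  show ?thesis
  proof (rule lipschitz_onI)
    fix s t :: real assume "s \<in> {0..}" "t \<in> {0..}"
    then show "dist (h s) (h t) \<le> L * dist s t"
      using inc[of s t] inc[of t s] by (cases "s \<le> t") (auto simp: dist_real_def abs_minus_commute)
  qed (fact \<open>L \<ge> 0\<close>)
qed

section \<open>Signals\<close>

lemma has_real_derivative_at_split:
  fixes g :: "real \<Rightarrow> real"
  assumes "(g has_real_derivative d) (at_left x)" "(g has_real_derivative d) (at_right x)"
  shows "(g has_real_derivative d) (at x)"
  using assms by (auto simp: has_field_derivative_iff filterlim_at_split)

text \<open>Carrying the derivatives as data on the whole line gives access to two-sided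
  differentiation rules and lets a chain be differenced term by term.\<close>

definition deriv_chain :: "nat \<Rightarrow> real \<Rightarrow> (nat \<Rightarrow> real \<Rightarrow> real) \<Rightarrow> bool" where
  "deriv_chain m L D \<longleftrightarrow>
     (\<forall>i<m. \<forall>t. (D i has_real_derivative D (Suc i) t) (at t)) \<and> L-lipschitz_on UNIV (D m)"

text \<open>The i-th derivative of the polynomial of degree at most m whose derivatives at 0 are the
  values of c.\<close>

definition taylor_deriv :: "nat \<Rightarrow> (nat \<Rightarrow> real) \<Rightarrow> nat \<Rightarrow> real \<Rightarrow> real" where
  "taylor_deriv m c i t = (\<Sum>k\<le>m - i. c (i + k) * t ^ k / fact k)"

lemma taylor_deriv_0: "taylor_deriv m c i 0 = c i"
  unfolding taylor_deriv_def by (subst sum.atMost_shift) simp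

lemma taylor_deriv_has_derivative:
  assumes "i < m"
  shows "(taylor_deriv m c i has_real_derivative taylor_deriv m c (Suc i) t) (at t)"
proof -
  have m: "m - i = Suc (m - Suc i)" using assms by simp
  have "(taylor_deriv m c i has_real_derivative
      (\<Sum>k\<le>m - i. c (i + k) * (real k * t ^ (k - 1)) / fact k)) (at t)"
    unfolding taylor_deriv_def[abs_def] by (auto intro!: derivative_eq_intros sum.cong simp: mult_ac)
  also have "(\<Sum>k\<le>m - i. c (i + k) * (real k * t ^ (k - 1)) / fact k)
      = (\<Sum>k\<le>m - Suc i. c (i + Suc k) * (real (Suc k) * t ^ k) / fact (Suc k))"
    unfolding m by (subst sum.atMost_Suc_shift) simp
  also have "\<dots> = taylor_deriv m c (Suc i) t"
    unfolding taylor_deriv_def by (intro sum.cong) (simp_all add: fact_Suc[of _] del: of_nat_Suc)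
  finally show ?thesis .
qed

text \<open>Extending a signal to negative times by its Taylor polynomial at 0 makes its
  backward differences at early times functions of the initial derivatives alone.\<close>

definition extended_deriv :: "nat \<Rightarrow> (real \<Rightarrow> real) \<Rightarrow> nat \<Rightarrow> real \<Rightarrow> real" where
  "extended_deriv m f i t =
     (if t \<ge> 0 then half_line_deriv i f t else taylor_deriv m (\<lambda>k. half_line_deriv k f 0) i t)"

lemma extended_deriv_nonneg: "t \<ge> 0 \<Longrightarrow> extended_deriv m f i t = half_line_deriv i f t"
  by (simp add: extended_deriv_def)

lemma extended_deriv_nonpos:
  "t \<le> 0 \<Longrightarrow> extended_deriv m f i t = taylor_deriv m (\<lambda>k. half_line_deriv k f 0) i t"
  by (cases "t = 0") (simp_all add: extended_deriv_def taylor_deriv_0)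

lemma deriv_chain_extended:
  assumes f: "f \<in> signal_class m L" and "L > 0"
  shows "deriv_chain m L (extended_deriv m f)"
  unfolding deriv_chain_def
proof (intro conjI allI impI)
  fix i t assume i: "i < m"
  let ?D = "extended_deriv m f"
  have right: "(?D i has_real_derivative ?D (Suc i) t) (at t within {0..})" if "t \<ge> 0"
  proof -
    have "half_line_deriv i f differentiable (at t within {0..})"
      using f i that by (auto simp: signal_class_def differentiable_on_def)
    then have "(half_line_deriv i f has_real_derivative half_line_deriv (Suc i) f t) (at t within {0..})"
      by (simp add: has_real_derivative_iff_has_vector_derivative vector_derivative_works)
    then show ?thesis
      unfolding extended_deriv_nonneg[OF that]
      by (rule has_field_derivative_transform_within[OF _ zero_less_one])
        (use that in \<open>auto simp: extended_deriv_nonneg\<close>)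
  qed
  have left: "(?D i has_real_derivative ?D (Suc i) t) (at t within {..0})" if "t \<le> 0"
    unfolding extended_deriv_nonpos[OF that]
    by (rule has_field_derivative_transform_within[OF
          has_field_derivative_at_within[OF taylor_deriv_has_derivative[OF i]] zero_less_one])
      (use that in \<open>auto simp: extended_deriv_nonpos\<close>)
  consider "t > 0" | "t < 0" | "t = 0" by linarith
  then show "(?D i has_real_derivative ?D (Suc i) t) (at t)"
  proof cases
    case 1
    then show ?thesis using right at_within_interior[of t "{0..}"] by simp
  next
    case 2
    then show ?thesis using left at_within_interior[of t "{..0}"] by simp
  next
    case 3
    have "(?D i has_real_derivative ?D (Suc i) t) (at_right t)"
      using right 3 by (simp add: at_within_Ici_at_right)
    moreover have "(?D i has_real_derivative ?D (Suc i) t) (at_left t)"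
      using left 3 by (simp add: at_within_Iic_at_left)
    ultimately show ?thesis by (rule has_real_derivative_at_split[rotated])
  qed
next
  obtain C where C: "C-lipschitz_on {0..} (half_line_deriv m f)"
    using f unfolding signal_class_def by blast
  have ae: "AE t in lebesgue_on {0..}. half_line_deriv m f differentiable (at t within {0..}) \<and>
      \<bar>vector_derivative (half_line_deriv m f) (at t within {0..})\<bar> \<le> L"
    using f unfolding signal_class_def mem_Collect_eq half_line_deriv.simps(2)
    by (elim conjE)
  have lip: "L-lipschitz_on {0..} (half_line_deriv m f)"
    using lipschitz_of_AE_deriv_bound[OF C less_imp_le[OF \<open>L > 0\<close>] ae] .
  \<comment> \<open>The top derivative of the Taylor polynomial is constant, so the extension just
    freezes the value at 0 and keeps the Lipschitz constant.\<close>
  have ext: "extended_deriv m f m t = half_line_deriv m f (max t 0)" for t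
    by (simp add: extended_deriv_def taylor_deriv_def max_def)
  show "L-lipschitz_on UNIV (extended_deriv m f m)"
  proof (rule lipschitz_onI)
    fix x y :: real
    have "dist (extended_deriv m f m x) (extended_deriv m f m y) \<le> L * dist (max x 0) (max y 0)"
      unfolding ext using lipschitz_onD[OF lip] by simp
    also have "\<dots> \<le> L * dist x y"
      using \<open>L > 0\<close> by (intro mult_left_mono) (auto simp: dist_real_def)
    finally show "dist (extended_deriv m f m x) (extended_deriv m f m y) \<le> L * dist x y" .
  qed (use \<open>L > 0\<close> in simp)
qed

section \<open>Backward differences\<close>

primrec bdiff :: "real \<Rightarrow> nat \<Rightarrow> (real \<Rightarrow> real) \<Rightarrow> real \<Rightarrow> real" where
  "bdiff T 0 F t = F t"
| "bdiff T (Suc i) F t = bdiff T i F t - bdiff T i F (t - T)"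

lemma bdiff_shift: "bdiff T i (\<lambda>t. F (t - T)) t = bdiff T i F (t - T)"
  by (induction i arbitrary: t) simp_all

lemma bdiff_Suc_inner: "bdiff T (Suc i) F t = bdiff T i (\<lambda>t. F t - F (t - T)) t"
proof (induction i arbitrary: t)
  case (Suc i)
  have "bdiff T (Suc (Suc i)) F t = bdiff T (Suc i) F t - bdiff T (Suc i) F (t - T)"
    by (rule bdiff.simps(2))
  then show ?case
    by (simp only: Suc.IH bdiff.simps(2)[of T i "\<lambda>t. F t - F (t - T)"])
qed simp

text \<open>At time 0 the differences see only the Taylor extension, which is why the initial error
  is determined by the initial derivatives.\<close>

lemma bdiff_cong_atMost:
  assumes "T \<ge> 0" "\<And>s. s \<le> t \<Longrightarrow> F s = G s"
  shows "bdiff T i F t = bdiff T i G t"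
  using assms(2)
proof (induction i arbitrary: t)
  case (Suc i)
  then have "bdiff T i F t = bdiff T i G t" "bdiff T i F (t - T) = bdiff T i G (t - T)"
    using \<open>T \<ge> 0\<close> by auto
  then show ?case by simp
qed simp

text \<open>Induction on m: the increments over T form a chain of one order less, whose top is
  Lipschitz with constant L * T by the mean value inequality.\<close>

lemma bdiff_bound:
  assumes "deriv_chain m L D" "T > 0"
  shows "\<bar>bdiff T (Suc m) (D 0) t\<bar> \<le> L * T ^ Suc m"
  using assms(1)
proof (induction m arbitrary: L D)
  case 0
  then show ?case
    using lipschitz_onD[of L UNIV "D 0" t "t - T"] \<open>T > 0\<close>
    by (simp add: deriv_chain_def dist_real_def)
next
  case (Suc m)
  let ?D = "\<lambda>i t. D i t - D i (t - T)"
  have D: "(D i has_real_derivative D (Suc i) t) (at t)" if "i \<le> m" for i t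
    using Suc.prems that by (auto simp: deriv_chain_def)
  have L: "L-lipschitz_on UNIV (D (Suc m))"
    using Suc.prems by (simp add: deriv_chain_def)
  have D': "(?D i has_real_derivative ?D (Suc i) t) (at t)" if "i \<le> m" for i t
  proof -
    have "((\<lambda>t. D i (t - T)) has_real_derivative D (Suc i) (t - T) * 1) (at t)"
      by (rule DERIV_chain2[OF D[OF that]]) (auto intro!: derivative_eq_intros)
    then show ?thesis
      using DERIV_diff[OF D[OF that]] by fastforce
  qed
  have "deriv_chain m (L * T) ?D"
    unfolding deriv_chain_def
  proof (intro conjI allI impI)
    show "(L * T)-lipschitz_on UNIV (?D m)"
    proof (rule lipschitz_onI)
      fix x y
      show "dist (?D m x) (?D m y) \<le> L * T * dist x y"
        unfolding dist_norm
      proof (rule field_differentiable_bound[of UNIV])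
        fix z
        show "norm (?D (Suc m) z) \<le> L * T"
          using lipschitz_onD[OF L, of z "z - T"] \<open>T > 0\<close> by (simp add: dist_real_def)
        show "(?D m has_real_derivative ?D (Suc m) z) (at z within UNIV)"
          using D'[of m z] by simp
      qed auto
    qed (use lipschitz_on_nonneg[OF L] \<open>T > 0\<close> in simp)
  qed (use D' in auto)
  then have "\<bar>bdiff T (Suc m) (?D 0) t\<bar> \<le> L * T * T ^ Suc m"
    by (rule Suc.IH)
  then show ?case
    by (subst bdiff_Suc_inner) (simp add: mult_ac)
qed

section \<open>Backward difference formulas\<close>

text \<open>The rising factorial s (s + 1) ... (s + j - 1) / j!, the Newton basis for the nodes 0,
  -1, -2, ...\<close>

primrec newton_poly :: "nat \<Rightarrow> real poly" where
  "newton_poly 0 = 1"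
| "newton_poly (Suc j) = smult (1 / real (Suc j)) (newton_poly j * [:real j, 1:])"

text \<open>Identifies the constants c: their recursion is multiplication by (s + j) / (j + 1), so
  \<open>c_const i j\<close> is the i-th derivative at 0 of the j-th Newton polynomial.\<close>

lemma coeff_newton_poly: "coeff (newton_poly j) i = c_const i j / fact i"
proof (induction j arbitrary: i)
  case 0
  show ?case by (cases i) auto
next
  case (Suc j)
  show ?case
  proof (cases i)
    case 0
    then show ?thesis using Suc[of 0] by (cases j) (auto simp: coeff_mult_0)
  next
    case (Suc l)
    have "newton_poly j * [:real j, 1:] = smult (real j) (newton_poly j) + pCons 0 (newton_poly j)"
      by simp
    then have "coeff (newton_poly (Suc j)) i
        = (real j * coeff (newton_poly j) (Suc l) + coeff (newton_poly j) l) / real (Suc j)"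
      unfolding newton_poly.simps by (simp del: mult_pCons_right add: Suc)
    then show ?thesis
      by (simp add: Suc Suc.IH field_simps del: of_nat_Suc)
  qed
qed

lemma degree_newton_poly: "degree (newton_poly j) \<le> j"
proof (induction j)
  case (Suc j)
  have "degree (newton_poly (Suc j)) \<le> degree (newton_poly j * [:real j, 1:])"
    by simp
  also have "\<dots> \<le> degree (newton_poly j) + degree [:real j, 1:]"
    by (rule degree_mult_le)
  finally show ?case using Suc by simp
qed simp

lemma poly_higher_pderiv_0: "poly ((pderiv ^^ i) p) 0 = fact i * coeff p i" for p :: "real poly"
proof (induction i arbitrary: p)
  case (Suc i)
  show ?case
    unfolding funpow_Suc_right comp_def Suc by (simp add: coeff_pderiv)
qed (simp add: poly_0_coeff_0)

lemma poly_newton_poly_Suc: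
  "real (Suc j) * poly (newton_poly (Suc j)) s = (s + real j) * poly (newton_poly j) s"
proof -
  have "poly [:real j, 1:] s = s + real j" by simp
  then show ?thesis
    by (simp only: newton_poly.simps poly_smult poly_mult) (simp del: of_nat_Suc)
qed

text \<open>Pascal's rule: backward differencing lowers the index. Shifting the factors s, ..., s +
  j down by one trades s + j for s - 1, which is the auxiliary identity.\<close>

lemma poly_newton_poly_shift:
  "poly (newton_poly (Suc j)) (s - 1) = poly (newton_poly (Suc j)) s - poly (newton_poly j) s"
proof -
  have "real (Suc j) * poly (newton_poly (Suc j)) (s - 1) = (s - 1) * poly (newton_poly j) s"
  proof (induction j)
    case (Suc j)
    have "real (Suc j) * (real (Suc (Suc j)) * poly (newton_poly (Suc (Suc j))) (s - 1))
        = (s + real j) * (real (Suc j) * poly (newton_poly (Suc j)) (s - 1))"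
      unfolding poly_newton_poly_Suc[of "Suc j"] by (simp del: newton_poly.simps)
    also have "\<dots> = (s + real j) * ((s - 1) * poly (newton_poly j) s)"
      by (simp only: Suc)
    also have "\<dots> = real (Suc j) * ((s - 1) * poly (newton_poly (Suc j)) s)"
      by (metis mult.left_commute poly_newton_poly_Suc)
    finally have "real (Suc j) * (real (Suc (Suc j)) * poly (newton_poly (Suc (Suc j))) (s - 1))
        = real (Suc j) * ((s - 1) * poly (newton_poly (Suc j)) s)" .
    then show ?case by (simp del: newton_poly.simps)
  qed simp
  then have "real (Suc j) * poly (newton_poly (Suc j)) (s - 1)
      = real (Suc j) * (poly (newton_poly (Suc j)) s - poly (newton_poly j) s)"
    unfolding right_diff_distrib poly_newton_poly_Suc by (simp add: algebra_simps)
  then show ?thesis by (simp del: newton_poly.simps)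
qed

lemma poly_newton_poly_zero: "l < j \<Longrightarrow> poly (newton_poly j) (- real l) = 0"
  by (induction j) (auto simp: less_Suc_eq)

text \<open>Induction on the node: the hypothesis is applied to the signal delayed by T, and
  summation by parts moves the resulting difference onto the Newton polynomials.\<close>

lemma newton_interpolation:
  "l \<le> m \<Longrightarrow> F (t - real l * T) = (\<Sum>j\<le>m. bdiff T j F t * poly (newton_poly j) (- real l))"
proof (induction l arbitrary: F)
  case 0
  have "(\<Sum>j\<le>m. bdiff T j F t * poly (newton_poly j) 0) = (\<Sum>j\<le>m. if j = 0 then F t else 0)"
    using poly_newton_poly_zero[of 0] by (intro sum.cong) auto
  then show ?case by simp
next
  case (Suc l)
  let ?q = "\<lambda>j. poly (newton_poly j) (- real l)"
  obtain m' where m: "m = Suc m'" using Suc.prems by (cases m) auto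
  have "F (t - real (Suc l) * T) = (\<lambda>t. F (t - T)) (t - real l * T)"
    by (simp add: algebra_simps)
  also have "\<dots> = (\<Sum>j\<le>m. (bdiff T j F t - bdiff T (Suc j) F t) * ?q j)"
    using Suc by (subst Suc.IH) (auto simp: bdiff_shift)
  \<comment> \<open>The term j = m of the second sum vanishes, as l < m makes - l a zero of the m-th
    Newton polynomial.\<close>
  also have "\<dots> = (\<Sum>j\<le>m. bdiff T j F t * ?q j) - (\<Sum>j\<le>m'. bdiff T (Suc j) F t * ?q j)"
    using poly_newton_poly_zero[of l m] Suc.prems
    by (simp add: left_diff_distrib sum_subtractf m del: newton_poly.simps bdiff.simps(2))
  also have "\<dots> = bdiff T 0 F t * ?q 0 + (\<Sum>j\<le>m'. bdiff T (Suc j) F t * (?q (Suc j) - ?q j))"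
    unfolding m by (subst sum.atMost_Suc_shift)
      (simp add: right_diff_distrib sum_subtractf del: newton_poly.simps bdiff.simps)
  also have "\<dots> = (\<Sum>j\<le>m. bdiff T j F t * poly (newton_poly j) (- real (Suc l)))"
  proof -
    have "- real (Suc l) = - real l - 1" by simp
    then show ?thesis
      unfolding m by (subst sum.atMost_Suc_shift) (simp only: poly_newton_poly_shift, simp)
  qed
  finally show ?case .
qed

lemma c_const_nonneg: "c_const i j \<ge> 0"
  by (induction i j rule: c_const.induct) auto

lemma c_const_pos: "\<lbrakk>1 \<le> i; i \<le> j\<rbrakk> \<Longrightarrow> c_const i j > 0"
proof (induction i j rule: c_const.induct)
  case (4 i j)
  have "real j * c_const (Suc i) j + real (Suc i) * c_const i j > 0"
  proof (cases "j = 0 \<or> i \<ge> 1")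
    case True
    then have "c_const i j > 0" using 4 by auto
    then show ?thesis using c_const_nonneg[of "Suc i" j] by (simp add: add_nonneg_pos)
  next
    case False
    then have "c_const (Suc i) j > 0" using 4 by auto
    then show ?thesis using False c_const_nonneg[of i j] by (simp add: add_pos_nonneg)
  qed
  then show ?case by simp
qed auto

lemma c_const_eq_0: "j < i \<Longrightarrow> c_const i j = 0"
  by (induction i j rule: c_const.induct) auto

lemma c_const_diag: "c_const i i = 1"
  by (induction i) (auto simp: c_const_eq_0)

text \<open>The largest zero is split off and Rolle's theorem applied between it and the next one.
  The position of the new zeros, strictly left of some old one, keeps them distinct here and later
  from 0.\<close>

lemma rolle_zeros:
  fixes h h' :: "real \<Rightarrow> real"
  assumes deriv: "\<And>x. (h has_real_derivative h' x) (at x)"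
  shows "\<lbrakk>finite Z; card Z = Suc n; \<forall>z\<in>Z. h z = 0\<rbrakk> \<Longrightarrow>
    \<exists>Z'. finite Z' \<and> card Z' = n \<and> (\<forall>z\<in>Z'. h' z = 0 \<and> (\<exists>w\<in>Z. z < w))"
proof (induction n arbitrary: Z)
  case 0
  then show ?case by (intro exI[of _ "{}"]) auto
next
  case (Suc n)
  define b where "b = Max Z"
  define A where "A = Z - {b}"
  have ne: "Z \<noteq> {}" using Suc.prems by auto
  have b: "b \<in> Z" unfolding b_def using Suc.prems ne by auto
  have A: "finite A" "card A = Suc n" "\<forall>z\<in>A. h z = 0"
    using Suc.prems b by (auto simp: A_def)
  then have neA: "A \<noteq> {}" by auto
  obtain Z' where Z': "finite Z'" "card Z' = n" "\<forall>z\<in>Z'. h' z = 0 \<and> (\<exists>w\<in>A. z < w)"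
    using Suc.IH[OF A] by blast
  define c where "c = Max A"
  have c: "c \<in> A" "\<And>w. w \<in> A \<Longrightarrow> w \<le> c" unfolding c_def using A neA by auto
  have "c < b"
    using c(1) Max_ge[OF Suc.prems(1), of c] by (auto simp: A_def b_def)
  moreover have "h c = h b" using A c b Suc.prems by auto
  ultimately obtain x where x: "c < x" "x < b" "h' x = 0"
    using Rolle_deriv[of c b h "\<lambda>x y. h' x * y"] deriv
    by (metis DERIV_isCont continuous_at_imp_continuous_on has_field_derivative_imp_has_derivative mult.right_neutral)
  have "x \<notin> Z'" using Z'(3) c(2) x(1) by force
  then show ?case
    using Z' x b by (intro exI[of _ "insert x Z'"]) (auto simp: A_def)
qed

lemma rolle_zeros_iterated:
  fixes G :: "nat \<Rightarrow> real \<Rightarrow> real"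
  assumes deriv: "\<And>k x. k < m \<Longrightarrow> (G k has_real_derivative G (Suc k) x) (at x)"
  shows "\<lbrakk>k + r \<le> m; finite Z; card Z = n + r; \<forall>z\<in>Z. G k z = 0\<rbrakk> \<Longrightarrow>
    \<exists>Z'. finite Z' \<and> card Z' = n \<and> (\<forall>z\<in>Z'. G (k + r) z = 0) \<and> (r > 0 \<longrightarrow> (\<forall>z\<in>Z'. \<exists>w\<in>Z. z < w))"
proof (induction r arbitrary: n)
  case 0
  then show ?case by (intro exI[of _ Z]) auto
next
  case (Suc r)
  obtain Z' where Z': "finite Z'" "card Z' = Suc n" "\<forall>z\<in>Z'. G (k + r) z = 0"
      "r > 0 \<longrightarrow> (\<forall>z\<in>Z'. \<exists>w\<in>Z. z < w)" "r = 0 \<Longrightarrow> Z' = Z"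
    using Suc.IH[of "Suc n"] Suc.prems by (cases "r = 0") auto
  obtain Z'' where Z'': "finite Z''" "card Z'' = n"
      "\<forall>z\<in>Z''. G (Suc (k + r)) z = 0 \<and> (\<exists>w\<in>Z'. z < w)"
    using rolle_zeros[of "G (k + r)" "G (Suc (k + r))", OF _ Z'(1-3)] deriv[of "k + r"] Suc.prems by auto
  moreover have "\<exists>w\<in>Z. z < w" if z: "z \<in> Z''" for z
  proof -
    obtain w where w: "w \<in> Z'" "z < w" using bspec[OF Z''(3) z] by (elim conjE bexE)
    show ?thesis
    proof (cases "r = 0")
      case True
      then show ?thesis using w Z'(5) by blast
    next
      case False
      then obtain w' where "w' \<in> Z" "w < w'" using Z'(4) w(1) by blast
      then show ?thesis using less_trans[OF w(2)] by (intro bexI[of _ w'])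
    qed
  qed
  ultimately show ?case by (intro exI[of _ Z'']) simp
qed

text \<open>The backward difference formula is exact for the Newton interpolation polynomial; the
  multiple \<open>\<kappa>\<close> of the next Newton polynomial is added to obtain one more zero at order \<open>i\<close>.\<close>

lemma backward_difference_formula_error:
  assumes chain: "deriv_chain m L D" and "T > 0" and i: "i \<in> {1..m}"
  shows "\<bar>T ^ i * D i t - (\<Sum>j=i..m. c_const i j * bdiff T j (D 0) t)\<bar>
    \<le> c_const i (Suc m) * L * T ^ Suc m"
proof -
  let ?b = "\<lambda>j. bdiff T j (D 0) t"
  define e where "e = T ^ i * D i t - (\<Sum>j=i..m. c_const i j * ?b j)"
  have c: "c_const i (Suc m) > 0" using i by (intro c_const_pos) auto
  \<comment> \<open>As \<open>c_const i (Suc m)\<close> is the i-th derivative of the added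
    polynomial at 0, this multiple cancels the error there; what remains is to bound
    \<kappa>.\<close>
  define \<kappa> where "\<kappa> = e / c_const i (Suc m)"
  define P where "P = (\<Sum>j\<le>m. smult (?b j) (newton_poly j)) + smult \<kappa> (newton_poly (Suc m))"
  have coeff_P: "fact k * coeff P k = (\<Sum>j\<le>m. ?b j * c_const k j) + \<kappa> * c_const k (Suc m)" for k
    unfolding P_def
    by (simp add: coeff_sum coeff_newton_poly sum_distrib_left distrib_left
        del: newton_poly.simps c_const.simps)
  have deg_P: "degree P \<le> Suc m"
  proof -
    have deg: "degree (smult r (newton_poly j)) \<le> Suc m" if "j \<le> Suc m" for r j
      using degree_smult_le[of r "newton_poly j"] degree_newton_poly[of j] that by linarith
    show ?thesis
      unfolding P_def by (intro degree_add_le degree_sum_le deg) auto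
  qed
  define G where "G k s = T ^ k * D k (t + s * T) - poly ((pderiv ^^ k) P) s" for k s
  have G: "(G k has_real_derivative G (Suc k) s) (at s)" if "k < m" for k s
  proof -
    have "(D k has_real_derivative D (Suc k) (t + s * T)) (at (t + s * T))"
      using chain that by (simp add: deriv_chain_def)
    then have "((\<lambda>s. D k (t + s * T)) has_real_derivative D (Suc k) (t + s * T) * T) (at s)"
      by (rule DERIV_chain2) (auto intro!: derivative_eq_intros)
    then show ?thesis
      unfolding G_def by (auto intro!: derivative_eq_intros)
  qed
  \<comment> \<open>The added multiple vanishes at all m + 1 nodes, so they stay zeros of
    \<open>G 0\<close>.\<close>
  define Z where "Z = (\<lambda>l. - real l) ` {..m}"
  have Z: "finite Z" "card Z = Suc (m - i) + i" "\<forall>z\<in>Z. G 0 z = 0" "\<forall>z\<in>Z. z \<le> 0"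
  proof -
    show "card Z = Suc (m - i) + i" unfolding Z_def using i by (subst card_image) (auto intro: inj_onI)
    show "\<forall>z\<in>Z. G 0 z = 0"
    proof
      fix z assume "z \<in> Z"
      then obtain l where l: "l \<le> m" "z = - real l" by (auto simp: Z_def)
      have "poly P z = (\<Sum>j\<le>m. ?b j * poly (newton_poly j) (- real l))"
        using poly_newton_poly_zero[of l "Suc m"] l
        by (simp add: P_def poly_sum del: newton_poly.simps)
      also have "\<dots> = D 0 (t - real l * T)"
        using newton_interpolation[OF l(1)] by simp
      finally show "G 0 z = 0" by (simp add: G_def l)
    qed
  qed (auto simp: Z_def)
  obtain Z1 where Z1: "finite Z1" "card Z1 = Suc (m - i)" "\<forall>z\<in>Z1. G i z = 0" "\<forall>z\<in>Z1. z < 0"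
    using rolle_zeros_iterated[of m G 0 i, OF G _ Z(1-3)] i Z(4) by fastforce
  have "G i 0 = 0"
  proof -
    have "(\<Sum>j=i..m. c_const i j * ?b j) = (\<Sum>j\<le>m. ?b j * c_const i j)"
      by (intro sum.mono_neutral_cong_left) (auto simp: c_const_eq_0 not_le)
    moreover have "\<kappa> * c_const i (Suc m) = e" using c by (simp add: \<kappa>_def)
    ultimately show ?thesis
      unfolding G_def poly_higher_pderiv_0 coeff_P by (simp add: e_def)
  qed
  \<comment> \<open>The i Rolle steps left m - i + 1 negative zeros; \<kappa> supplies 0 as one
    more, and m - i further steps will leave two.\<close>
  with Z1 have Z2: "finite (insert 0 Z1)" "card (insert 0 Z1) = 2 + (m - i)" "\<forall>z\<in>insert 0 Z1. G i z = 0"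
    by auto
  obtain Z3 where "card Z3 = 2" "\<forall>z\<in>Z3. G (i + (m - i)) z = 0"
    using rolle_zeros_iterated[of m G i "m - i", OF G _ Z2] i by auto
  moreover have "i + (m - i) = m" using i by simp
  ultimately obtain x y where xy: "x < y" "G m x = 0" "G m y = 0"
    by (auto simp: card_2_iff) (metis linorder_neqE_linordered_idom)
  define p where "p = (pderiv ^^ m) P"
  \<comment> \<open>The derivative of \<open>P\<close> of order m + 1 is the constant \<kappa>, so
    the two zeros of \<open>G m\<close> exhibit \<kappa> as a difference quotient of the rescaled
    m-th derivative of the signal.\<close>
  have "degree (pderiv p) = 0"
  proof -
    have "degree ((pderiv ^^ k) P) = degree P - k" for k
      by (induction k) (auto simp: degree_pderiv)
    from this[of "Suc m"] show ?thesis using deg_P by (simp add: p_def)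
  qed
  then obtain d where d: "pderiv p = [:d:]" by (rule degree_eq_zeroE)
  have "poly ((pderiv ^^ Suc m) P) 0 = \<kappa>"
    unfolding poly_higher_pderiv_0 coeff_P
    by (simp only: c_const_diag) (simp add: c_const_eq_0 del: c_const.simps)
  then have "d = \<kappa>" using d by (simp add: p_def)
  then have "poly p y - poly p x = (y - x) * \<kappa>"
    using poly_MVT[OF xy(1), of p] d by auto
  moreover have "poly p y - poly p x = T ^ m * (D m (t + y * T) - D m (t + x * T))"
    using xy by (simp add: G_def p_def algebra_simps)
  ultimately have "(y - x) * \<bar>\<kappa>\<bar> = T ^ m * \<bar>D m (t + y * T) - D m (t + x * T)\<bar>"
    using xy(1) \<open>T > 0\<close> by (metis abs_mult abs_of_pos diff_gt_0_iff_gt zero_less_power)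
  also have "\<dots> \<le> T ^ m * (L * ((y - x) * T))"
  proof -
    have "dist (D m (t + y * T)) (D m (t + x * T)) \<le> L * dist (t + y * T) (t + x * T)"
      using chain unfolding deriv_chain_def by (intro lipschitz_onD[of L UNIV]) auto
    also have "dist (t + y * T) (t + x * T) = (y - x) * T"
      using xy(1) \<open>T > 0\<close> by (simp add: dist_real_def left_diff_distrib[symmetric])
    finally show ?thesis
      using \<open>T > 0\<close> by (intro mult_left_mono) (auto simp: dist_real_def)
  qed
  finally have "(y - x) * \<bar>\<kappa>\<bar> \<le> (y - x) * (L * T ^ Suc m)"
    by (simp add: mult_ac)
  then have "\<bar>\<kappa>\<bar> \<le> L * T ^ Suc m"
    using xy(1) by simp
  then have "c_const i (Suc m) * \<bar>\<kappa>\<bar> \<le> c_const i (Suc m) * (L * T ^ Suc m)"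
    using c by (intro mult_left_mono) auto
  moreover have "\<bar>e\<bar> = c_const i (Suc m) * \<bar>\<kappa>\<bar>"
    using c by (simp add: \<kappa>_def abs_divide del: c_const.simps)
  ultimately show ?thesis
    unfolding e_def by (simp add: mult_ac del: c_const.simps)
qed

section \<open>The differentiator\<close>

text \<open>With n = m + 1 and j = n - i, the injection terms of all components i become integer
  signed powers of one common root.\<close>

lemma signed_pow_homogeneous:
  assumes "L > 0" "0 < j" "j < n"
  shows "L powr (real (n - j) / real n) * signed_pow w (real j / real n) = L * spow j (root n (w / L))"
proof (cases "w = 0")
  case False
  have n: "n > 0" using assms by simp
  have "\<bar>root n (w / L)\<bar> = root n (\<bar>w\<bar> / L)"
    using assms n by (metis abs_divide abs_of_pos real_root_abs)
  also have "\<dots> = (\<bar>w\<bar> / L) powr (1 / real n)"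
    using False assms n by (simp add: root_powr_inverse)
  finally have "\<bar>root n (w / L)\<bar> ^ j = ((\<bar>w\<bar> / L) powr (1 / real n)) powr real j"
    using False assms by (simp add: powr_realpow)
  also have "\<dots> = \<bar>w\<bar> powr (real j / real n) / L powr (real j / real n)"
    using assms by (simp add: powr_powr powr_divide)
  finally have abs: "\<bar>root n (w / L)\<bar> ^ j = \<bar>w\<bar> powr (real j / real n) / L powr (real j / real n)" .
  have "sgn (root n (w / L)) = sgn w"
    using assms n False by (cases "w > 0") (auto simp: sgn_if divide_less_0_iff zero_less_divide_iff)
  moreover have "L powr (real (n - j) / real n) = L / L powr (real j / real n)"
  proof -
    have "real (n - j) / real n = 1 - real j / real n"
      using assms by (simp add: of_nat_diff diff_divide_distrib)
    then show ?thesis using assms by (simp add: powr_diff)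
  qed
  ultimately show ?thesis
    unfolding spow_def signed_pow_def abs by simp
qed (simp add: signed_pow_def)

text \<open>The time is (k - 1) * T because \<open>z i (k + 1)\<close> is formed from the sample at
  k * T. For k = 1, differences of positive order reach back to negative times.\<close>

definition tracking_error :: "real \<Rightarrow> (real \<Rightarrow> real) \<Rightarrow> (nat \<Rightarrow> nat \<Rightarrow> real) \<Rightarrow> nat \<Rightarrow> nat \<Rightarrow> real" where
  "tracking_error T F z k i = z i k - bdiff T (i - 1) F ((real k - 1) * T) / T ^ (i - 1)"

text \<open>The increment of the signal part is the difference of next order, which is just what
  turns \<open>z (i + 1)\<close> into its tracking error.\<close>

lemma tracking_error_Suc:
  assumes "T > 0" "i \<ge> 1"
  shows "tracking_error T F z (Suc k) i - tracking_error T F z k i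
    = z i (Suc k) - z i k - T * (bdiff T i F (real k * T) / T ^ i)"
proof -
  obtain l where i: "i = Suc l" using assms by (cases i) auto
  have "T * (bdiff T i F (real k * T) / T ^ i) = bdiff T i F (real k * T) / T ^ l"
    using assms by (simp add: i del: bdiff.simps)
  moreover have "bdiff T i F (real k * T) = bdiff T l F (real k * T) - bdiff T l F ((real k - 1) * T)"
    by (simp add: i algebra_simps)
  ultimately have "T * (bdiff T i F (real k * T) / T ^ i)
      = bdiff T l F (real k * T) / T ^ l - bdiff T l F ((real k - 1) * T) / T ^ l"
    by (simp only: diff_divide_distrib)
  moreover have "i - 1 = l" "real (Suc k) - 1 = real k" using i by auto
  ultimately show ?thesis
    by (simp only: tracking_error_def)
qed

context error_cascade
begin

definition error_roots :: "real \<Rightarrow> (nat \<Rightarrow> real) \<Rightarrow> nat \<Rightarrow> real" where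
  "error_roots L x j = (if j \<in> {1..Suc m} then root j (- x (m + 2 - j) / (L * \<Lambda> j)) else 0)"

lemma spow_error_roots:
  assumes "j \<in> {1..Suc m}" "L > 0"
  shows "\<Lambda> j * spow j (error_roots L x j) = - x (m + 2 - j) / L"
  using assms \<Lambda>_pos[of j] by (simp add: error_roots_def spow_root)

lemma step_of_trajectory:
  assumes L: "L > 0" and chain: "deriv_chain m L D"
    and \<Lambda>_eq: "\<And>j. \<Lambda> j = lam (m + 1 - j)"
    and traj: "differentiator_trajectory m T L lam zinit u z" and k: "k \<ge> 1"
  shows "\<exists>E. step (root (Suc m) ((u k - z 1 (Suc k)) / L)) E
      (error_roots L (tracking_error T (D 0) z k)) (error_roots L (tracking_error T (D 0) z (Suc k)))
    \<and> E (Suc m) = (u k - D 0 (real k * T)) / L"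
proof -
  let ?x = "tracking_error T (D 0) z"
  let ?w = "u k - z 1 (Suc k)"
  define s where "s = root (Suc m) (?w / L)"
  define R where "R k = error_roots L (?x k)" for k
  \<comment> \<open>For positive j the injection relation of \<open>step\<close> holds by definition
    and the update must be shown; for j = 0 it is the update that holds by definition.\<close>
  define E where "E j = (if j = 0 then (?x (Suc k) (m + 1) - ?x k (m + 1)) / (T * L)
      else \<Lambda> j * (spow j s - spow j (R (Suc k) j)))" for j
  have R: "\<Lambda> j * spow j (R k j) = - ?x k (m + 2 - j) / L" if "j \<in> {1..Suc m}" for j k
    unfolding R_def using that L by (rule spow_error_roots)
  have eqs: "z i (k + 1) = z i k + T * lam i * L powr (real i / real (m + 1))
        * signed_pow (u k - z 1 (k + 1)) (real (m - i + 1) / real (m + 1)) + T * z (i + 1) (k + 1)"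
    if "i \<in> {1..m}" for i
    using traj k that unfolding differentiator_trajectory_def by blast
  have upd: "\<Lambda> (Suc j) * (spow (Suc j) (R k (Suc j)) - spow (Suc j) (R (Suc k) (Suc j))) = T * E j"
    if j: "j \<le> m" for j
  proof -
    have "\<Lambda> (Suc j) * (spow (Suc j) (R k (Suc j)) - spow (Suc j) (R (Suc k) (Suc j)))
        = (?x (Suc k) (m + 1 - j) - ?x k (m + 1 - j)) / L"
      using j by (simp add: right_diff_distrib R diff_divide_distrib)
    also have "\<dots> = T * E j"
    proof (cases "j = 0")
      case True
      then show ?thesis using T_pos by (simp add: E_def)
    next
      case False
      define i where "i = m + 1 - j"
      have i: "i \<in> {1..m}" "m - i + 1 = j" "m + 1 - j = i" "m + 2 - j = i + 1" "i = Suc m - j"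
        using False j by (auto simp: i_def)
      have "z i (Suc k) - z i k
          = T * lam i * L powr (real i / real (m + 1)) * signed_pow ?w (real j / real (m + 1))
            + T * z (i + 1) (Suc k)"
        using eqs[OF i(1), unfolded i(2)] by simp
      also have "L powr (real i / real (m + 1)) * signed_pow ?w (real j / real (m + 1)) = L * spow j s"
        using signed_pow_homogeneous[of L j "Suc m" ?w] L False j i by (simp add: s_def)
      then have "T * lam i * L powr (real i / real (m + 1)) * signed_pow ?w (real j / real (m + 1))
          = T * lam i * (L * spow j s)"
        by (metis mult.assoc)
      finally have "?x (Suc k) i - ?x k i = T * (L * (lam i * spow j s) + ?x (Suc k) (i + 1))"
        using i T_pos by (subst tracking_error_Suc) (auto simp: tracking_error_def algebra_simps)
      moreover have "\<Lambda> j * spow j (R (Suc k) j) = - ?x (Suc k) (i + 1) / L"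
        using R[of j "Suc k"] False j i by simp
      moreover have "\<Lambda> j = lam i" using \<Lambda>_eq i by simp
      ultimately have "E j = lam i * spow j s + ?x (Suc k) (i + 1) / L"
        and "?x (Suc k) i - ?x k i = T * (L * (lam i * spow j s) + ?x (Suc k) (i + 1))"
        using False by (simp_all add: E_def right_diff_distrib)
      then show ?thesis
        unfolding i(3) using L by (simp add: add_divide_distrib distrib_left)
    qed
    finally show ?thesis .
  qed
  have "z (m + 1) (k + 1) \<in> last_state_rhs m T L lam u z k"
    using traj k unfolding differentiator_trajectory_def by blast
  then have "\<exists>\<sigma>\<in>signed_pow0 ?w. z (m + 1) (Suc k) = z (m + 1) k + T * lam (m + 1) * L * \<sigma>"
    by (simp add: last_state_rhs_def image_iff)
  then obtain \<sigma> where \<sigma>: "\<sigma> \<in> signed_pow0 ?w"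
      "z (m + 1) (Suc k) = z (m + 1) k + T * lam (m + 1) * L * \<sigma>"
    by blast
  \<comment> \<open>The backward difference of order m + 1, normalized by L, acts as the disturbance
    of the last component; its bound 1 explains \<open>\<Lambda> 0 + 1\<close> and
    \<open>\<Lambda> 0 - 1\<close> in \<open>step\<close>.\<close>
  define \<delta> where "\<delta> = bdiff T (Suc m) (D 0) (real k * T) / (L * T ^ Suc m)"
  have \<delta>: "\<bar>\<delta>\<bar> \<le> 1"
  proof -
    have "\<bar>\<delta>\<bar> = \<bar>bdiff T (Suc m) (D 0) (real k * T)\<bar> / (L * T ^ Suc m)"
      using L T_pos by (simp add: \<delta>_def abs_divide abs_mult del: bdiff.simps)
    also have "\<dots> \<le> (L * T ^ Suc m) / (L * T ^ Suc m)"
      using bdiff_bound[OF chain T_pos] L T_pos by (intro divide_right_mono) auto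
    finally show ?thesis using L T_pos by simp
  qed
  have "?x (Suc k) (m + 1) - ?x k (m + 1) = T * lam (m + 1) * L * \<sigma> - T * (L * \<delta>)"
    using \<sigma>(2) T_pos L by (subst tracking_error_Suc) (auto simp: \<delta>_def simp del: bdiff.simps)
  then have "E 0 = (T * L) * (lam (m + 1) * \<sigma> - \<delta>) / (T * L)"
    by (simp add: E_def algebra_simps)
  then have E0: "E 0 = \<Lambda> 0 * \<sigma> - \<delta>"
    using T_pos L \<Lambda>_eq[of 0] by simp
  have \<sigma>1: "\<bar>\<sigma>\<bar> \<le> 1"
    using \<sigma>(1) by (auto simp: signed_pow0_def sgn_if split: if_splits)
  have "\<bar>E 0\<bar> \<le> \<Lambda> 0 * \<bar>\<sigma>\<bar> + \<bar>\<delta>\<bar>"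
    unfolding E0 using \<Lambda>_0 by (intro order_trans[OF abs_triangle_ineq4]) (simp add: abs_mult)
  also have "\<dots> \<le> \<Lambda> 0 * 1 + 1"
    using \<sigma>1 \<delta> \<Lambda>_0 by (intro add_mono mult_left_mono) auto
  finally have "\<bar>E 0\<bar> \<le> \<Lambda> 0 + 1" by simp
  moreover have "\<sigma> = 1" if "s > 0"
    using that \<sigma>(1) L by (auto simp: s_def signed_pow0_def zero_less_divide_iff)
  moreover have "\<sigma> = - 1" if "s < 0"
    using that \<sigma>(1) L by (auto simp: s_def signed_pow0_def divide_less_0_iff)
  moreover have "\<forall>j\<in>{1..Suc m}. E j = \<Lambda> j * (spow j s - spow j (R (Suc k) j))"
    by (simp add: E_def)
  ultimately have "step s E (R k) (R (Suc k))"
    using upd \<delta> unfolding step_def by (auto simp: E0 abs_le_iff)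
  moreover have "E (Suc m) = (u k - D 0 (real k * T)) / L"
  proof -
    \<comment> \<open>The state \<open>z 1\<close> cancels between the injection argument and its
      tracking error, so only the noise is left.\<close>
    have "E (Suc m) = spow (Suc m) s - \<Lambda> (Suc m) * spow (Suc m) (R (Suc k) (Suc m))"
      by (simp add: E_def \<Lambda>_top)
    also have "\<dots> = ?w / L + ?x (Suc k) 1 / L"
      using R[of "Suc m" "Suc k"] by (simp add: s_def spow_root)
    also have "\<dots> = (u k - D 0 (real k * T)) / L"
      by (simp add: tracking_error_def diff_divide_distrib)
    finally show ?thesis .
  qed
  ultimately show ?thesis unfolding s_def R_def by blast
qed

lemma tracking_error_le:
  assumes "V (error_roots L x) \<le> \<rho>" "L > 0" "j \<in> {1..Suc m}"
  shows "\<bar>x (m + 2 - j)\<bar> \<le> L * \<Lambda> j * (\<beta> j * \<rho>) ^ j"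
proof -
  have j: "j > 0" "\<Lambda> j > 0" using assms \<Lambda>_pos[of j] by auto
  have "\<bar>x (m + 2 - j)\<bar> = L * \<bar>\<Lambda> j * spow j (error_roots L x j)\<bar>"
    unfolding spow_error_roots[OF assms(3,2)] using assms(2) by (simp add: abs_divide)
  also have "\<dots> = L * \<Lambda> j * \<bar>error_roots L x j\<bar> ^ j"
    using j by (simp add: abs_mult abs_spow)
  also have "\<dots> \<le> L * \<Lambda> j * (\<beta> j * \<rho>) ^ j"
    using abs_le_\<beta>[OF assms(1,3)] assms(2) j by (intro mult_left_mono power_mono) auto
  finally show ?thesis .
qed

end

text \<open>The output is the backward difference formula with the states in place of the scaled
  differences, so truncation error and weighted tracking errors add up.\<close>

lemma output_error_le:
  assumes chain: "deriv_chain m L D" and T: "T > 0" and i: "i \<in> {1..m}"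
    and B: "\<And>p. p \<in> {1..m} \<Longrightarrow> \<bar>tracking_error T (D 0) z (Suc k) (m + 2 - p)\<bar> \<le> B p"
  shows "\<bar>differentiator_output m T z i k - D i (real k * T)\<bar>
    \<le> c_const i (m + 1) * L * T ^ (m - i + 1)
      + (\<Sum>p=1..m - i + 1. T ^ (m - i + 1 - p) * c_const i (m - p + 1) * B p)"
proof -
  let ?x = "tracking_error T (D 0) z (Suc k)"
  let ?S = "\<Sum>j=i..m. c_const i j * bdiff T j (D 0) (real k * T)"
  have "differentiator_output m T z i k = (\<Sum>j=i..m. T ^ (j - i) * c_const i j * ?x (j + 1)
      + c_const i j * bdiff T j (D 0) (real k * T) / T ^ i)"
    unfolding differentiator_output_def
  proof (intro sum.cong refl)
    fix j assume j: "j \<in> {i..m}"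
    then have "T ^ j = T ^ (j - i) * T ^ i" by (simp add: power_add[symmetric])
    then show "T ^ (j - i) * c_const i j * z (j + 1) (k + 1) = T ^ (j - i) * c_const i j * ?x (j + 1)
        + c_const i j * bdiff T j (D 0) (real k * T) / T ^ i"
      using T by (simp add: tracking_error_def field_simps)
  qed
  then have split: "differentiator_output m T z i k
      = (\<Sum>j=i..m. T ^ (j - i) * c_const i j * ?x (j + 1)) + ?S / T ^ i"
    by (simp add: sum.distrib sum_divide_distrib)
  have "\<bar>\<Sum>j=i..m. T ^ (j - i) * c_const i j * ?x (j + 1)\<bar>
      \<le> (\<Sum>j=i..m. T ^ (j - i) * c_const i j * B (m + 1 - j))"
  proof (intro order_trans[OF sum_abs] sum_mono)
    fix j assume j: "j \<in> {i..m}"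
    then have "\<bar>?x (j + 1)\<bar> \<le> B (m + 1 - j)"
    proof -
      have "m + 1 - j \<in> {1..m}" "m + 2 - (m + 1 - j) = j + 1" using j i by auto
      then show ?thesis using B[of "m + 1 - j"] by simp
    qed
    then show "\<bar>T ^ (j - i) * c_const i j * ?x (j + 1)\<bar> \<le> T ^ (j - i) * c_const i j * B (m + 1 - j)"
      using T c_const_nonneg[of i j] by (simp add: abs_mult mult_left_mono)
  qed
  also have "\<dots> = (\<Sum>p=1..m - i + 1. T ^ (m - i + 1 - p) * c_const i (m - p + 1) * B p)"
    using i by (intro sum.reindex_bij_witness[of _ "\<lambda>p. m + 1 - p" "\<lambda>j. m + 1 - j"])
      (auto simp: Suc_diff_le)
  finally have 1: "\<bar>\<Sum>j=i..m. T ^ (j - i) * c_const i j * ?x (j + 1)\<bar> \<le> \<dots>" .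
  have "\<bar>?S / T ^ i - D i (real k * T)\<bar> = \<bar>T ^ i * D i (real k * T) - ?S\<bar> / T ^ i"
  proof -
    have "?S / T ^ i - D i (real k * T) = - (T ^ i * D i (real k * T) - ?S) / T ^ i"
      using T by (simp add: field_simps)
    then show ?thesis using T by (simp add: abs_divide abs_minus_commute)
  qed
  also have "\<dots> \<le> (c_const i (Suc m) * L * T ^ Suc m) / T ^ i"
    using backward_difference_formula_error[OF chain T i] T by (intro divide_right_mono) auto
  also have "\<dots> = c_const i (m + 1) * L * T ^ (m - i + 1)"
  proof -
    have "T ^ Suc m = T ^ (m - i + 1) * T ^ i"
      using i by (simp add: power_add[symmetric] del: power_Suc)
    then show ?thesis using T by (simp del: c_const.simps power_Suc)
  qed
  finally have "\<bar>?S / T ^ i - D i (real k * T)\<bar> \<le> \<dots>" .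
  with 1 show ?thesis unfolding split by linarith
qed

section \<open>Matching the constants of the theorem\<close>

text \<open>Turns the parameter condition, with \<open>\<mu> j\<close> written out, into
  \<open>gain\<close>: \<open>L0\<close>, \<open>L1\<close>, \<open>L2\<close> are consecutive
  values of \<open>\<Lambda>\<close>, and c is \<open>a j - 1\<close>.\<close>

lemma gain_condition:
  fixes L0 L1 L2 b g g' c r :: real
  assumes "L0 > 0" "L1 > 0" "L2 > 0" "b > 0" "g > 0" "g' > 0" "c > 0" "r > 0"
    and "L1 / L2 > L0 / L1 * ((r + 1) / r * (g / g') * (b / c))"
  shows "(r + 1) * b * L2 * (2 * L0 / g') < r * L1 * (2 * c * L1 / g)"
proof -
  have 1: "L0 / L1 * ((r + 1) / r * (g / g') * (b / c)) * (2 * L1 * L2 * r * c / g)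
      < L1 / L2 * (2 * L1 * L2 * r * c / g)"
    using assms by (intro mult_strict_right_mono) auto
  have 2: "L0 / L1 * ((r + 1) / r * (g / g') * (b / c)) * (2 * L1 * L2 * r * c / g)
      = (r + 1) * b * L2 * (2 * L0 / g')"
    using assms by (simp add: divide_simps)
  have 3: "L1 / L2 * (2 * L1 * L2 * r * c / g) = r * L1 * (2 * c * L1 / g)"
    using assms by (simp add: divide_simps)
  show ?thesis using 1 unfolding 2 3 .
qed

text \<open>Term by term comparison with the binomial expansion: each lower bound on d is the value
  at which the terms of index p agree, whence the maximum in the theorem.\<close>

lemma binomial_lower_bound:
  fixes T N c d :: real
  assumes "T \<ge> 0" "N \<ge> 0" "c > 0"
    and w: "\<And>p. p \<in> {1..q} \<Longrightarrow> w p \<ge> 0" and b: "\<And>p. p \<in> {1..q} \<Longrightarrow> b p \<ge> 0"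
    and d: "\<And>p. p \<in> {1..q} \<Longrightarrow> b p * root p (w p / (real (q choose p) * c)) \<le> d"
  shows "c * T ^ q + (\<Sum>p=1..q. T ^ (q - p) * w p * (b p * N) ^ p) \<le> c * (T + d * N) ^ q"
proof -
  have "T ^ (q - p) * w p * (b p * N) ^ p \<le> c * (real (q choose p) * (d * N) ^ p * T ^ (q - p))"
    if p: "p \<in> {1..q}" for p
  proof -
    have C: "real (q choose p) > 0" using p by simp
    have "(b p * root p (w p / (real (q choose p) * c))) ^ p \<le> d ^ p"
      using b[OF p] w[OF p] C \<open>c > 0\<close> p by (intro power_mono d mult_nonneg_nonneg) auto
    then have "(b p) ^ p * (w p / (real (q choose p) * c)) \<le> d ^ p"
      using w[OF p] C \<open>c > 0\<close> p by (simp add: power_mult_distrib)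
    then have "(b p) ^ p * (w p / (real (q choose p) * c)) * (real (q choose p) * c)
        \<le> d ^ p * (real (q choose p) * c)"
      using C \<open>c > 0\<close> by (intro mult_right_mono) auto
    then have "(b p) ^ p * w p \<le> d ^ p * (real (q choose p) * c)"
      using C \<open>c > 0\<close> by simp
    then have "(b p) ^ p * w p * (N ^ p * T ^ (q - p))
        \<le> d ^ p * (real (q choose p) * c) * (N ^ p * T ^ (q - p))"
      using assms(1,2) by (intro mult_right_mono) auto
    then show ?thesis by (simp add: power_mult_distrib mult_ac)
  qed
  then have "(\<Sum>p=1..q. T ^ (q - p) * w p * (b p * N) ^ p)
      \<le> (\<Sum>p=1..q. c * (real (q choose p) * (d * N) ^ p * T ^ (q - p)))"
    by (rule sum_mono)
  moreover have "c * (T + d * N) ^ q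
      = c * T ^ q + (\<Sum>p=1..q. c * (real (q choose p) * (d * N) ^ p * T ^ (q - p)))"
  proof -
    have "(T + d * N) ^ q = (\<Sum>p\<le>q. real (q choose p) * (d * N) ^ p * T ^ (q - p))"
      by (subst add.commute) (rule binomial_ring)
    also have "{..q} = insert 0 {1..q}" by auto
    finally show ?thesis by (simp add: sum_distrib_left distrib_left)
  qed
  ultimately show ?thesis by linarith
qed

lemma powr_inverse_power: "x > 0 \<Longrightarrow> j > 0 \<Longrightarrow> (x powr (1 / real j)) ^ j = x"
  by (simp add: powr_realpow[symmetric] powr_powr)

text \<open>The noise threshold is the conclusion solved for N. The cases q = 1 and q = 2 provide
  the premises of \<open>sliding_if_small\<close>.\<close>

lemma small_noise_bound:
  assumes "L > 0" "T > 0" "q > 0" "b > 0" "g > 0" "l > 0" "A > 0" "N \<ge> 0"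
    and N: "N \<le> L * T ^ (m + 1) / (2 ^ m * b ^ (m + 1) * g ^ (m + 1))
      * (A / l) powr (real (m + 1) / real q)"
    and \<rho>: "\<rho> = g * root (m + 1) (N / L) / root (m + 1) 2"
  shows "l * (b * \<rho>) ^ q \<le> (T / 2) ^ q * A"
proof -
  define P where "P = (A / l) powr (1 / real q)"
  have P: "P > 0" "P ^ q = A / l"
    using assms by (auto simp: P_def powr_inverse_power)
  have "P ^ (m + 1) = P powr real (m + 1)"
    using P(1) by (simp only: powr_realpow)
  also have "\<dots> = (A / l) powr (real (m + 1) / real q)"
    by (simp add: P_def powr_powr)
  finally have Pn: "P ^ (m + 1) = (A / l) powr (real (m + 1) / real q)" .
  \<comment> \<open>The 2 under the root in \<rho> joins the 2 ^ m of the threshold to give (T / 2)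
    ^ (m + 1).\<close>
  have "(b * \<rho>) ^ (m + 1) = b ^ (m + 1) * g ^ (m + 1) / (2 * L) * N"
    using assms by (simp add: \<rho> power_mult_distrib power_divide del: power_Suc)
  also have "\<dots> \<le> b ^ (m + 1) * g ^ (m + 1) / (2 * L)
      * (L * T ^ (m + 1) / (2 ^ m * b ^ (m + 1) * g ^ (m + 1)) * P ^ (m + 1))"
    unfolding Pn using assms by (intro mult_left_mono N) auto
  also have "\<dots> = (T / 2 * P) ^ (m + 1)"
    using assms by (simp add: power_mult_distrib power_divide divide_simps)
  finally have "b * \<rho> \<le> T / 2 * P"
    using assms P by (subst (asm) power_mono_iff) (auto simp: \<rho>)
  then have "(b * \<rho>) ^ q \<le> (T / 2 * P) ^ q"
    using assms by (intro power_mono) (auto simp: \<rho>)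
  also have "\<dots> = (T / 2) ^ q * (A / l)"
    by (simp only: power_mult_distrib P)
  finally have "l * (b * \<rho>) ^ q \<le> l * ((T / 2) ^ q * (A / l))"
    using assms by (intro mult_left_mono) auto
  then show ?thesis using assms by simp
qed

theorem theorem3p8:
  fixes m :: nat and L T :: real
    and a \<beta> \<gamma> \<mu> lam d zinit :: "nat \<Rightarrow> real"
    and Nbar :: real
  assumes "m \<ge> 1" and "L > 0" and "T > 0"
    and "\<forall>j\<in>{1..m}. 1 < a j \<and> a j < 2"
    and "\<beta> 1 = 1" and "\<gamma> 0 = 2" and "\<gamma> 1 = 2"
    and "\<forall>j\<in>{1..m}. \<beta> (j + 1) = (\<beta> j ^ j + a j / \<gamma> j ^ j) powr (1 / real j)"
    and "\<forall>j\<in>{1..m}. \<gamma> (j + 1) = (2 / (2 - a j)) powr (1 / real j) * \<gamma> j"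
    and "\<forall>j\<in>{1..m}. \<mu> j =
           (real j + 1) / real j * (\<gamma> j ^ j / \<gamma> (j - 1) ^ (j - 1)) * (\<beta> (j + 1) / (a j - 1))"
    and "lam 0 = 1"
    and "\<forall>i\<in>{1..m + 1}. lam i > 0"
    and "lam (m + 1) > 1"
    and "\<forall>j\<in>{1..m}.
           lam (m - j + 1) / lam (m - j) > lam (m - j + 2) / lam (m - j + 1) * \<mu> j"
    and "\<forall>i\<in>{1..m}. d i =
           (MAX p\<in>{1..m - i + 1}.
              \<beta> p * \<gamma> (m + 1) / root (m + 1) 2
              * root p (lam (m - p + 1) * c_const i (m - p + 1)
                        / (real ((m - i + 1) choose p) * c_const i (m + 1))))"
    and "Nbar =
           (MIN p\<in>{0..m}.
              L * T ^ (m + 1) / (2 ^ m * \<beta> (m - p + 1) ^ (m + 1) * \<gamma> (m + 1) ^ (m + 1))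
              * ((lam (m + 1) - 1) / lam p) powr (real (m + 1) / real (m - p + 1)))"
  shows "\<forall>N\<ge>0. \<forall>finit :: nat \<Rightarrow> real. \<exists>K\<ge>1.
           \<forall>f\<in>signal_class m L. \<forall>\<eta>\<in>noise_class N. \<forall>u z.
             (\<forall>i\<le>m. half_line_deriv i f 0 = finit i) \<longrightarrow>
             (\<forall>k\<ge>1. u k = f (real k * T) + \<eta> k) \<longrightarrow>
             differentiator_trajectory m T L lam zinit u z \<longrightarrow>
               (\<forall>i\<in>{1..m}. \<forall>k\<ge>K.
                  \<bar>differentiator_output m T z i k - half_line_deriv i f (real k * T)\<bar>
                    \<le> c_const i (m + 1) * L * (T + d i * root (m + 1) (N / L)) ^ (m - i + 1)) \<and>
               (N \<le> Nbar \<longrightarrow> (\<forall>k\<ge>K. sliding_mode m T L lam u z k))"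
proof (intro allI impI)
  note m = \<open>m \<ge> 1\<close> and L = \<open>L > 0\<close> and T = \<open>T > 0\<close>
  note a = assms(4)[rule_format] and lam_pos = assms(12)[rule_format] and lam_cond = assms(14)[rule_format]
  have \<gamma>_pos: "\<gamma> j > 0" if "j \<le> Suc m" for j
    using that
  proof (induction j)
    case (Suc j)
    then show ?case
      using assms(7) assms(9)[rule_format, of j] a[of j] by (cases "j = 0") auto
  qed (simp add: assms(6))
  have \<beta>_base: "\<beta> j ^ j + a j / \<gamma> j ^ j > 0" if "j \<in> {1..m}" "\<beta> j > 0" for j
    using that a[of j] \<gamma>_pos[of j] by (intro add_pos_pos) auto
  have \<beta>_pos: "\<beta> (Suc j) > 0" if "j \<le> m" for j
    using that
  proof (induction j)
    case (Suc j)
    then show ?case using \<beta>_base[of "Suc j"] assms(8)[rule_format, of "Suc j"] by simp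
  qed (use assms(5) in simp)
  have \<beta>_pos': "\<beta> j > 0" if "j \<in> {1..Suc m}" for j
    using \<beta>_pos[of "j - 1"] that by auto
  have lam_pos': "lam (m + 1 - j) > 0" if "j \<le> Suc m" for j
    using that lam_pos[of "m + 1 - j"] assms(11) by (cases "j = Suc m") auto
  \<comment> \<open>Reversing the index turns \<open>lam 0 = 1\<close> into
    \<open>\<Lambda> (Suc m) = 1\<close>, so that the noise enters unweighted, and
    \<open>lam (m + 1) > 1\<close> into \<open>\<Lambda> 0 > 1\<close>.\<close>
  interpret error_cascade m T a \<beta> \<gamma> "\<lambda>j. lam (m + 1 - j)"
  proof
    fix j assume j: "j \<in> {1..m}"
    show "\<beta> (Suc j) ^ j = \<beta> j ^ j + a j / \<gamma> j ^ j"
      unfolding Suc_eq_plus1 assms(8)[rule_format, OF j]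
      by (intro powr_inverse_power \<beta>_base \<beta>_pos') (use j in auto)
    show "(2 - a j) * \<gamma> (Suc j) ^ j = 2 * \<gamma> j ^ j"
    proof -
      have "((2 / (2 - a j)) powr (1 / real j)) ^ j = 2 / (2 - a j)"
        by (intro powr_inverse_power) (use a[OF j] j in auto)
      then show ?thesis
        unfolding Suc_eq_plus1 assms(9)[rule_format, OF j] power_mult_distrib
        using a[OF j] by simp
    qed
    have idx: "m - j + 2 = m + 1 - (j - 1)" "m - j + 1 = m + 1 - j" "m - j = m + 1 - Suc j"
      using j by auto
    have "lam (m + 1 - j) / lam (m + 1 - Suc j)
        > lam (m + 1 - (j - 1)) / lam (m + 1 - j) * ((real j + 1) / real j
          * (\<gamma> j ^ j / \<gamma> (j - 1) ^ (j - 1)) * (\<beta> (Suc j) / (a j - 1)))"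
      using lam_cond[OF j]
      unfolding idx(1,2) unfolding idx(3) assms(10)[rule_format, OF j] Suc_eq_plus1[of j, symmetric] .
    then have "(real j + 1) * \<beta> (Suc j) * lam (m + 1 - Suc j)
        * (2 * lam (m + 1 - (j - 1)) / \<gamma> (j - 1) ^ (j - 1))
      < real j * lam (m + 1 - j) * (2 * (a j - 1) * lam (m + 1 - j) / \<gamma> j ^ j)"
      by (intro gain_condition lam_pos' \<beta>_pos' zero_less_power \<gamma>_pos) (use a[OF j] j in auto)
    then show "real (Suc j) * \<beta> (Suc j) * lam (m + 1 - Suc j)
        * (2 * lam (m + 1 - (j - 1)) / \<gamma> (j - 1) ^ (j - 1))
      < real j * lam (m + 1 - j) * (2 * (a j - 1) * lam (m + 1 - j) / \<gamma> j ^ j)"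
      by (simp only: of_nat_Suc add.commute)
    show "1 < a j \<and> a j < 2" using j by (rule a)
  next
    show "lam (m + 1 - Suc m) = 1" "lam (m + 1 - 0) > 1"
      using assms(11,13) by simp_all
  qed (fact m T assms(5,7) \<beta>_pos' \<gamma>_pos lam_pos')+
  fix N :: real and finit :: "nat \<Rightarrow> real"
  assume N: "0 \<le> N"
  \<comment> \<open>Solves 2 (\<rho> / \<gamma> (m+1))^(m+1) = N / L, the top-level bound of the
    cascade.\<close>
  define \<rho> where "\<rho> = \<gamma> (m + 1) * root (m + 1) (N / L) / root (m + 1) 2"
  have \<rho>: "\<rho> \<ge> 0" using N L \<gamma>_pos[of "m + 1"] by (simp add: \<rho>_def)
  have \<rho>_pow: "2 * (\<rho> / \<gamma> (Suc m)) ^ Suc m = N / L"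
    using \<gamma>_pos[of "m + 1"] N L by (simp add: \<rho>_def power_divide del: power_Suc)
  \<comment> \<open>Built from \<open>zinit\<close> and \<open>finit\<close> alone, so K is fixed
    before the signal and the noise are chosen.\<close>
  define R1 where "R1 = error_roots L
    (\<lambda>i. zinit i - bdiff T (i - 1) (taylor_deriv m finit 0) 0 / T ^ (i - 1))"
  obtain K where K: "K \<ge> 1" "\<And>R s E. V (R 1) \<le> V R1 \<Longrightarrow>
      \<forall>k\<ge>1. step (s k) (E k) (R k) (R (Suc k)) \<Longrightarrow>
      \<forall>k\<ge>1. \<bar>E k (Suc m)\<bar> \<le> 2 * (\<rho> / \<gamma> (Suc m)) ^ Suc m \<Longrightarrow> \<forall>k\<ge>K. V (R k) \<le> \<rho>"
    using finite_time_convergence[OF \<rho>, of "V R1"] by metis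
  have main: "(\<forall>i\<in>{1..m}. \<forall>k\<ge>K.
        \<bar>differentiator_output m T z i k - half_line_deriv i f (real k * T)\<bar>
          \<le> c_const i (m + 1) * L * (T + d i * root (m + 1) (N / L)) ^ (m - i + 1)) \<and>
      (N \<le> Nbar \<longrightarrow> (\<forall>k\<ge>K. sliding_mode m T L lam u z k))"
    if f: "f \<in> signal_class m L" and \<eta>: "\<eta> \<in> noise_class N"
      and init: "\<forall>i\<le>m. half_line_deriv i f 0 = finit i"
      and u: "\<forall>k\<ge>1. u k = f (real k * T) + \<eta> k"
      and traj: "differentiator_trajectory m T L lam zinit u z" for f \<eta> u z
  proof -
    define D where "D = extended_deriv m f"
    have chain: "deriv_chain m L D"
      unfolding D_def by (rule deriv_chain_extended[OF f L])
    have D: "D i (real k * T) = half_line_deriv i f (real k * T)" for i k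
      using T by (simp add: D_def extended_deriv_nonneg)
    define x where "x = tracking_error T (D 0) z"
    define s where "s k = root (Suc m) ((u k - z 1 (Suc k)) / L)" for k
    have "\<forall>k. \<exists>E. k \<ge> 1 \<longrightarrow> step (s k) E (error_roots L (x k)) (error_roots L (x (Suc k)))
        \<and> E (Suc m) = (u k - D 0 (real k * T)) / L"
      using step_of_trajectory[OF L chain refl traj] unfolding s_def x_def by blast
    then obtain E where E: "\<And>k. k \<ge> 1 \<Longrightarrow>
        step (s k) (E k) (error_roots L (x k)) (error_roots L (x (Suc k)))"
      "\<And>k. k \<ge> 1 \<Longrightarrow> E k (Suc m) = (u k - D 0 (real k * T)) / L"
      by metis
    have "error_roots L (x 1) = R1"
    proof
      fix j
      have "bdiff T i (D 0) 0 = bdiff T i (taylor_deriv m finit 0) 0" for i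
        using T init unfolding D_def
        by (intro bdiff_cong_atMost) (auto simp: extended_deriv_nonpos taylor_deriv_def)
      moreover have "z i 1 = zinit i" if "i \<in> {1..m + 1}" for i
        using traj that unfolding differentiator_trajectory_def by blast
      ultimately have x1: "x 1 i = zinit i - bdiff T (i - 1) (taylor_deriv m finit 0) 0 / T ^ (i - 1)"
        if "i \<in> {1..m + 1}" for i
        using that by (simp add: x_def tracking_error_def)
      show "error_roots L (x 1) j = R1 j"
      proof (cases "j \<in> {1..Suc m}")
        case True
        then have "m + 2 - j \<in> {1..m + 1}" by auto
        then show ?thesis
          unfolding R1_def error_roots_def by (simp only: x1)
      qed (simp only: R1_def error_roots_def if_False)
    qed
    moreover have "\<bar>E k (Suc m)\<bar> \<le> 2 * (\<rho> / \<gamma> (Suc m)) ^ Suc m" if "k \<ge> 1" for k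
    proof -
      have "u k = D 0 (real k * T) + \<eta> k" "\<bar>\<eta> k\<bar> \<le> N"
        using u \<eta> that D[of 0 k] by (auto simp: noise_class_def)
      then have "E k (Suc m) = \<eta> k / L" "\<bar>\<eta> k\<bar> / L \<le> N / L"
        using E(2)[OF that] L by (simp_all add: divide_right_mono)
      then show ?thesis
        unfolding \<rho>_pow using L by simp
    qed
    ultimately have V: "V (error_roots L (x k)) \<le> \<rho>" if "k \<ge> K" for k
      using K(2)[of "\<lambda>k. error_roots L (x k)" s E] E(1) that by simp
    show ?thesis
    proof (intro conjI ballI allI impI)
      fix i k assume i: "i \<in> {1..m}" and k: "k \<ge> K"
      let ?c = "c_const i (m + 1)" and ?N = "root (m + 1) (N / L)" and ?q = "m - i + 1"
      let ?w = "\<lambda>p. lam (m - p + 1) * c_const i (m - p + 1)"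
      let ?b = "\<lambda>p. \<beta> p * \<gamma> (m + 1) / root (m + 1) 2"
      have bN: "\<beta> p * \<rho> = ?b p * ?N" for p by (simp add: \<rho>_def)
      \<comment> \<open>The output at index k reads the states at k + 1.\<close>
      have xb: "\<bar>x (Suc k) (m + 2 - p)\<bar> \<le> L * lam (m + 1 - p) * (\<beta> p * \<rho>) ^ p"
        if "p \<in> {1..m}" for p
        using tracking_error_le[OF V L, of "Suc k" p] k that by simp
      have "\<bar>differentiator_output m T z i k - half_line_deriv i f (real k * T)\<bar>
          \<le> ?c * L * T ^ ?q + (\<Sum>p=1..?q. T ^ (?q - p) * c_const i (m - p + 1)
              * (L * lam (m + 1 - p) * (\<beta> p * \<rho>) ^ p))"
        by (rule output_error_le[OF chain T i xb[unfolded x_def], unfolded D])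
      also have "\<dots> = L * (?c * T ^ ?q + (\<Sum>p=1..?q. T ^ (?q - p) * ?w p * (?b p * ?N) ^ p))"
      proof -
        have "T ^ (?q - p) * c_const i (m - p + 1) * (L * lam (m + 1 - p) * (\<beta> p * \<rho>) ^ p)
            = L * (T ^ (?q - p) * ?w p * (?b p * ?N) ^ p)" if "p \<in> {1..?q}" for p
        proof -
          have "m + 1 - p = m - p + 1" using that i by auto
          then show ?thesis unfolding bN by (simp only: mult_ac)
        qed
        then have "(\<Sum>p=1..?q. T ^ (?q - p) * c_const i (m - p + 1)
              * (L * lam (m + 1 - p) * (\<beta> p * \<rho>) ^ p))
            = L * (\<Sum>p=1..?q. T ^ (?q - p) * ?w p * (?b p * ?N) ^ p)"
          unfolding sum_distrib_left by (rule sum.cong[OF refl])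
        then show ?thesis by (simp only: distrib_left mult_ac)
      qed
      also have "\<dots> \<le> L * (?c * (T + d i * ?N) ^ ?q)"
      proof (intro mult_left_mono binomial_lower_bound)
        fix p assume p: "p \<in> {1..?q}"
        then have pm: "p \<in> {1..m}" using i by auto
        show "?w p \<ge> 0"
          using lam_pos[of "m - p + 1"] pm c_const_nonneg by simp
        show "?b p \<ge> 0"
          using \<beta>_pos'[of p] \<gamma>_pos[of "m + 1"] pm by simp
        show "?b p * root p (?w p / (real (?q choose p) * ?c)) \<le> d i"
          using assms(15) i p by (auto intro!: Max_ge)
      next
        show "?c > 0" using i by (intro c_const_pos) auto
      qed (use T L N in auto)
      finally show "\<bar>differentiator_output m T z i k - half_line_deriv i f (real k * T)\<bar>
          \<le> ?c * L * (T + d i * ?N) ^ ?q"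
        by (simp only: mult_ac)
    next
      fix k assume "N \<le> Nbar" and k: "k \<ge> K"
      \<comment> \<open>The instance q belongs to the entry p = m + 1 - q of the minimum.\<close>
      have small: "lam (m + 1 - q) * (\<beta> q * \<rho>) ^ q \<le> (T / 2) ^ q * (lam (m + 1) - 1)"
        if q: "q \<in> {1..m + 1}" for q
      proof -
        define p where "p = m + 1 - q"
        have p: "p \<in> {0..m}" "m - p + 1 = q" using q by (auto simp: p_def)
        have "Nbar \<le> L * T ^ (m + 1) / (2 ^ m * \<beta> (m - p + 1) ^ (m + 1) * \<gamma> (m + 1) ^ (m + 1))
              * ((lam (m + 1) - 1) / lam p) powr (real (m + 1) / real (m - p + 1))"
          unfolding assms(16) using p(1) by (intro Min_le) auto
        with \<open>N \<le> Nbar\<close> have "N \<le> L * T ^ (m + 1) / (2 ^ m * \<beta> q ^ (m + 1) * \<gamma> (m + 1) ^ (m + 1))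
              * ((lam (m + 1) - 1) / lam p) powr (real (m + 1) / real q)"
          unfolding p(2) by linarith
        moreover have "lam p > 0" using \<Lambda>_pos[of q] q by (simp add: p_def)
        ultimately show ?thesis
          using small_noise_bound[OF L T, of q "\<beta> q" "\<gamma> (m + 1)" "lam p" "lam (m + 1) - 1" N m \<rho>]
            q \<beta>_pos'[of q] \<gamma>_pos[of "m + 1"] assms(13) N
          unfolding p_def \<rho>_def by simp
      qed
      have "k \<ge> 1" using k K(1) by simp
      have "s k = 0"
      proof (rule sliding_if_small[OF E(1)[OF \<open>k \<ge> 1\<close>], of \<rho>])
        show "lam (m + 1 - 1) * \<rho> \<le> T / 2 * (lam (m + 1 - 0) - 1)"
          using small[of 1] assms(5) by simp
        show "lam (m + 1 - 2) * (\<beta> 2 * \<rho>)\<^sup>2 \<le> T\<^sup>2 / 4 * (lam (m + 1 - 0) - 1)"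
          using small[of 2] m by (simp add: power_divide)
      qed (use V k in auto)
      then have "z 1 (k + 1) = u k"
        using L by (simp add: s_def)
      then show "sliding_mode m T L lam u z k"
        using sliding_mode_iff[of T L lam m] T L lam_pos[of "m + 1"] by simp
    qed
  qed
  show "\<exists>K\<ge>1. \<forall>f\<in>signal_class m L. \<forall>\<eta>\<in>noise_class N. \<forall>u z.
      (\<forall>i\<le>m. half_line_deriv i f 0 = finit i) \<longrightarrow>
      (\<forall>k\<ge>1. u k = f (real k * T) + \<eta> k) \<longrightarrow>
      differentiator_trajectory m T L lam zinit u z \<longrightarrow>
        (\<forall>i\<in>{1..m}. \<forall>k\<ge>K.
           \<bar>differentiator_output m T z i k - half_line_deriv i f (real k * T)\<bar>
             \<le> c_const i (m + 1) * L * (T + d i * root (m + 1) (N / L)) ^ (m - i + 1)) \<and>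
        (N \<le> Nbar \<longrightarrow> (\<forall>k\<ge>K. sliding_mode m T L lam u z k))"
    using main K(1) by blast
qed

end
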